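(* There is $\varepsilon_0 > 0$ such that for every $0<\varepsilon < \varepsilon_0$ there are $n_0(\varepsilon)$ and $t_0(\varepsilon)$ such that for all $n > n_0(\varepsilon)$ the following holds. Let $t\ge1$ be an integer with $2n^{1-\varepsilon/7} \le t \le n- 2$ and $t > t_0(\varepsilon)$, and let $\mathcal{F}\subset \mathcal{T}_n$ be $t$-intersecting. Then there exist a $t$-intersecting family $\mathcal S$ of forests in $K_n$, each with at most $t + n^{1 - \varepsilon/6}$ edges, and a family $\mathcal{F}'\subset \mathcal{F}$ such that: (i) $\mathcal{F}\setminus \mathcal{F}'\subset \mathcal{T}_n[\mathcal{S}]$; (ii) for every $B\in \mathcal{S}$ there is a family $\mathcal{F}_B\subset \mathcal{F}$ such that $\mathcal{F}_B(B)$ is $10\varepsilon t$-spread; (iii) $|\mathcal{F}'|\le 2^{-\frac 12 n^{1-\varepsilon/4}}c_{n, t}\,n^{n-2-t}$.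
   Context: $\mathcal{T}_n$ is the set of labelled spanning trees of $K_n$ on $[n]$; all graphs are regarded as sets of edges of $K_n$. A family is $t$-intersecting if any two members share at least $t$ edges. For a family $\mathcal{G}$ and a set $X$: $\mathcal{G}(X) = \{A\setminus X: A\in\mathcal{G}, X\subset A\}$, $\mathcal{G}[X]=\{A\in\mathcal{G}: X\subset A\}$, and $\mathcal{G}[\mathcal{S}]=\bigcup_{X\in\mathcal{S}}\mathcal{G}[X]$. For $r>1$, a family $\mathcal{G}$ of edge sets is $r$-spread if $|\mathcal{G}(Y)|<r^{-|Y|}|\mathcal{G}|$ for every nonempty set of edges $Y$. $c_{n,t}$ is the largest product of $n-t$ positive integers with sum $n$. *)

theory Defs
  imports Complex_Main "HOL-Library.Ramsey"
begin

abbreviation K_edges :: "nat \<Rightarrow> nat set set" where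
  "K_edges n \<equiv> [{1..n}]\<^bsup>2\<^esup>"

(* The vertices of the cycle are listed in cyclic order, without repeating the first one. *)
definition is_cycle :: "'v set set \<Rightarrow> 'v list \<Rightarrow> bool" where
  "is_cycle E vs \<longleftrightarrow> length vs \<ge> 3 \<and> distinct vs \<and>
     (\<forall>i < length vs. {vs ! i, vs ! (Suc i mod length vs)} \<in> E)"

definition connects :: "'v set set \<Rightarrow> 'v set \<Rightarrow> bool" where
  "connects E V \<longleftrightarrow> (\<forall>u\<in>V. \<forall>v\<in>V. (u, v) \<in> {(x, y). {x, y} \<in> E}\<^sup>*)"

definition forests :: "nat \<Rightarrow> nat set set set" where
  "forests n = {E. E \<subseteq> K_edges n \<and> (\<nexists>vs. is_cycle E vs)}"

definition spanning_trees :: "nat \<Rightarrow> nat set set set" where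
  "spanning_trees n = {E \<in> forests n. connects E {1..n}}"

(* The two members are allowed to coincide, so every member has at least t elements. *)
definition t_intersecting :: "nat \<Rightarrow> 'a set set \<Rightarrow> bool" where
  "t_intersecting t \<G> \<longleftrightarrow> (\<forall>A\<in>\<G>. \<forall>B\<in>\<G>. t \<le> card (A \<inter> B))"

text \<open>For a family \<open>\<G>\<close>, the notations \<open>\<G>(X)\<close>, \<open>\<G>[X]\<close> and \<open>\<G>[\<S>]\<close> are rendered as
  \<open>fam_link \<G> X\<close>, \<open>fam_star \<G> X\<close> and \<open>fam_stars \<G> \<S>\<close>.\<close>

definition fam_link :: "'a set set \<Rightarrow> 'a set \<Rightarrow> 'a set set" where
  "fam_link \<G> X = {A - X | A. A \<in> \<G> \<and> X \<subseteq> A}"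

definition fam_star :: "'a set set \<Rightarrow> 'a set \<Rightarrow> 'a set set" where
  "fam_star \<G> X = {A \<in> \<G>. X \<subseteq> A}"

definition fam_stars :: "'a set set \<Rightarrow> 'a set set \<Rightarrow> 'a set set" where
  "fam_stars \<G> \<S> = (\<Union>X\<in>\<S>. fam_star \<G> X)"

(* U is the ground set; the strict inequality excludes the empty family (if U is nonempty). *)
definition spread :: "'a set \<Rightarrow> real \<Rightarrow> 'a set set \<Rightarrow> bool" where
  "spread U r \<G> \<longleftrightarrow> r > 1 \<and>
     (\<forall>Y. Y \<subseteq> U \<and> Y \<noteq> {} \<longrightarrow>
        real (card (fam_link \<G> Y)) < r powi (- int (card Y)) * real (card \<G>))"

definition c_max :: "nat \<Rightarrow> nat \<Rightarrow> nat" where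
  "c_max n t = Max {prod_list xs | xs :: nat list.
     length xs = n - t \<and> (\<forall>x \<in> set xs. x > 0) \<and> sum_list xs = n}"

end

theory Submission
  imports Defs "HOL-Library.Transitive_Closure_Table" "HOL-Real_Asymp.Real_Asymp"
begin

text \<open>
  Call \<open>B\<close> an \<open>r\<close>-spread centre of \<open>F\<close> if \<open>F\<^sub>B(B)\<close> is \<open>r\<close>-spread for some \<open>F\<^sub>B \<subseteq> F\<close>. A nonempty
  \<open>G \<subseteq> F\<close> whose members all contain \<open>T\<close> has a centre \<open>B\<close> with \<open>|G| \<le> r\<^bsup>|B| - |T|\<^esup> |G[B]|\<close>. If no member
  of \<open>G\<close> contains a small centre, then \<open>B\<close> is large and \<open>G\<close> is small, because few trees contain a
  large forest. When \<open>F\<close> is already covered by a \<open>u\<close>-intersecting family of sets of size at most \<open>w\<close>,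
  every member contains one of at most \<open>w choose u\<close> sets \<open>T\<close> of size \<open>u\<close>.

  Taking \<open>r = \<surd>n\<close>, this lowers the maximal size of the centres one by one from \<open>n\<close> down to
  \<open>t + n powr (1 - \<epsilon>/5)\<close>, while averaging shows that all centres are \<open>(t - 2\<surd>n)\<close>-intersecting. A last
  step with \<open>r = 10 \<epsilon> t\<close> gives the centres of the theorem. Two of these, \<open>B\<close> and \<open>B'\<close>, share \<open>t\<close> edges:
  \<open>B' - B\<close> is much smaller than \<open>r\<close>, so most members of the two spread pieces avoid the other
  centre, and a two-round version of the spread lemma finds two of them that are disjoint outside
  the centres.
\<close>

section \<open>Spread families\<close>

lemma fam_star_subset: "fam_star G X \<subseteq> G"
  by (auto simp: fam_star_def)

lemma card_fam_link: "card (fam_link G X) = card (fam_star G X)"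
proof -
  have "fam_link G X = (\<lambda>A. A - X) ` fam_star G X"
    by (auto simp: fam_link_def fam_star_def)
  moreover have "inj_on (\<lambda>A. A - X) (fam_star G X)"
    by (auto simp: inj_on_def fam_star_def)
  ultimately show ?thesis
    by (simp add: card_image)
qed

lemma card_fam_star_fam_link:
  "card (fam_star (fam_link G B) Y) = (if Y \<inter> B = {} then card (fam_star G (B \<union> Y)) else 0)"
proof (cases "Y \<inter> B = {}")
  case True
  then have "fam_star (fam_link G B) Y = fam_link (fam_star G (B \<union> Y)) B"
    by (auto simp: fam_star_def fam_link_def)
  moreover have "fam_star (fam_star G (B \<union> Y)) B = fam_star G (B \<union> Y)"
    by (auto simp: fam_star_def)
  ultimately show ?thesis
    using True by (simp add: card_fam_link)
next
  case False
  then have "fam_star (fam_link G B) Y = {}"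
    by (auto simp: fam_star_def fam_link_def)
  then show ?thesis
    using False by simp
qed

lemma spread_iff:
  "spread U r G \<longleftrightarrow> r > 1 \<and>
     (\<forall>Y. Y \<subseteq> U \<and> Y \<noteq> {} \<longrightarrow> r ^ card Y * real (card (fam_star G Y)) < real (card G))"
proof -
  have "real (card (fam_link G Y)) < r powi (- int (card Y)) * real (card G)
      \<longleftrightarrow> r ^ card Y * real (card (fam_star G Y)) < real (card G)" if "r > 1" for Y
    using that by (simp add: card_fam_link power_int_minus field_simps)
  then show ?thesis
    by (auto simp: spread_def)
qed

lemma spread_singleton_empty:
  assumes "r > 1"
  shows "spread U r {{}}"
proof -
  have "fam_star {{}} Y = {}" if "Y \<noteq> {}" for Y :: "'a set"
    using that by (auto simp: fam_star_def)
  then show ?thesis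
    using assms by (simp add: spread_iff)
qed

definition heavy :: "real \<Rightarrow> 'a set set \<Rightarrow> 'a set \<Rightarrow> 'a set \<Rightarrow> bool" where
  "heavy r G T B \<longleftrightarrow> T \<subseteq> B \<and> real (card G) \<le> r ^ (card B - card T) * real (card (fam_star G B))"

lemma spread_fam_link_if_maximal_heavy:
  assumes "finite U" "B \<subseteq> U" "0 < card G" "r > 1" and heavy: "heavy r G T B"
    and maximal: "\<And>B'. B' \<subseteq> U \<Longrightarrow> heavy r G T B' \<Longrightarrow> card B' \<le> card B"
  shows "spread U r (fam_link G B)"
proof -
  have "finite B" "T \<subseteq> B"
    using heavy assms(1,2) finite_subset by (auto simp: heavy_def)
  have star_pos: "0 < card (fam_star G B)"
    using heavy assms(3) by (auto simp: heavy_def intro: Nat.gr0I)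
  have "r ^ card Y * real (card (fam_star G (B \<union> Y))) < real (card (fam_star G B))"
    if "Y \<subseteq> U" "Y \<noteq> {}" "Y \<inter> B = {}" for Y
  proof -
    have "finite Y"
      using that(1) assms(1) finite_subset by blast
    then have card_BY: "card (B \<union> Y) = card B + card Y" "0 < card Y"
      using \<open>finite B\<close> that by (auto simp: card_Un_disjoint Int_commute card_gt_0_iff)
    then have "\<not> heavy r G T (B \<union> Y)"
      using maximal[of "B \<union> Y"] \<open>B \<subseteq> U\<close> that(1) by auto
    then have "r ^ (card (B \<union> Y) - card T) * real (card (fam_star G (B \<union> Y))) < real (card G)"
      using \<open>T \<subseteq> B\<close> by (auto simp: heavy_def)
    also have "\<dots> \<le> r ^ (card B - card T) * real (card (fam_star G B))"
      using heavy by (simp add: heavy_def)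
    also have "card (B \<union> Y) - card T = (card B - card T) + card Y"
      using card_BY card_mono[OF \<open>finite B\<close> \<open>T \<subseteq> B\<close>] by simp
    finally show ?thesis
      using \<open>r > 1\<close> by (simp add: power_add mult.assoc)
  qed
  then show ?thesis
    using star_pos \<open>r > 1\<close> by (simp add: spread_iff card_fam_star_fam_link card_fam_link)
qed

lemma ex_heavy_spread_fam_link:
  assumes "finite U" "G \<subseteq> Pow U" "G \<noteq> {}" "r > 1" and contains: "\<And>A. A \<in> G \<Longrightarrow> T \<subseteq> A"
  shows "\<exists>B\<subseteq>U. heavy r G T B \<and> spread U r (fam_link G B)"
proof -
  have "finite G"
    using assms(1,2) by (meson finite_Pow_iff finite_subset)
  then have "0 < card G"
    using assms(3) by (simp add: card_gt_0_iff)
  have "fam_star G T = G" "T \<subseteq> U"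
    using contains assms(2,3) by (auto simp: fam_star_def)
  then have "T \<subseteq> U \<and> heavy r G T T"
    by (simp add: heavy_def)
  moreover have "\<forall>B. B \<subseteq> U \<and> heavy r G T B \<longrightarrow> card B < Suc (card U)"
    using assms(1) by (simp add: card_mono less_Suc_eq_le)
  ultimately have "\<exists>B. (B \<subseteq> U \<and> heavy r G T B) \<and> (\<forall>B'. B' \<subseteq> U \<and> heavy r G T B' \<longrightarrow> card B' \<le> card B)"
    by (rule ex_has_greatest_nat)
  then obtain B where heavy_B: "B \<subseteq> U" "heavy r G T B"
    and maximal: "\<And>B'. B' \<subseteq> U \<Longrightarrow> heavy r G T B' \<Longrightarrow> card B' \<le> card B"
    by auto
  have "spread U r (fam_link G B)"
    by (rule spread_fam_link_if_maximal_heavy[OF assms(1) heavy_B(1) \<open>0 < card G\<close> \<open>r > 1\<close> heavy_B(2)])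
      (simp add: maximal)
  with heavy_B show ?thesis
    by blast
qed

locale set_family =
  fixes U :: "'a set" and G :: "'a set set"
  assumes finite_ground: "finite U" and ground_nonempty: "U \<noteq> {}" and subset_Pow: "G \<subseteq> Pow U"
begin

lemma finite_family: "finite G"
  using finite_ground subset_Pow by (meson finite_Pow_iff finite_subset)

lemma finite_member: "A \<in> G \<Longrightarrow> finite A"
  using finite_ground subset_Pow finite_subset by blast

end

locale spread_family = set_family U G for U :: "'a set" and G :: "'a set set" +
  fixes r :: real
  assumes spread: "spread U r G"
begin

lemma ratio_gt_1: "r > 1"
  using spread by (simp add: spread_iff)

lemma family_nonempty: "G \<noteq> {}"
proof
  assume "G = {}"
  moreover have "r ^ card U * real (card (fam_star G U)) < real (card G)"
    using spread ground_nonempty by (simp add: spread_iff)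
  ultimately show False
    by (simp add: fam_star_def)
qed

lemma power_mult_card_fam_star_le: "r ^ card Y * real (card (fam_star G Y)) \<le> real (card G)"
proof (cases "Y \<subseteq> U \<and> Y \<noteq> {}")
  case True
  then show ?thesis
    using spread by (simp add: spread_iff less_imp_le)
next
  case False
  then consider (empty) "Y = {}" | (outside) "fam_star G Y = {}"
    using subset_Pow by (auto simp: fam_star_def)
  then show ?thesis
  proof cases
    case outside
    then show ?thesis
      by (simp only: card.empty)
  qed (simp add: fam_star_def)
qed

lemma sum_card_Int_le:
  assumes "finite C"
  shows "r * (\<Sum>A\<in>G. real (card (A \<inter> C))) \<le> real (card C) * real (card G)"
proof -
  have "(\<Sum>A\<in>G. card {c\<in>C. c \<in> A}) = (\<Sum>c\<in>C. card {A\<in>G. c \<in> A})"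
    using finite_family assms by (intro sum_multicount_gen) auto
  moreover have "{c\<in>C. c \<in> A} = A \<inter> C" for A
    by blast
  ultimately have "(\<Sum>A\<in>G. real (card (A \<inter> C))) = (\<Sum>c\<in>C. real (card (fam_star G {c})))"
    by (simp add: fam_star_def flip: of_nat_sum)
  then have "r * (\<Sum>A\<in>G. real (card (A \<inter> C))) = (\<Sum>c\<in>C. r * real (card (fam_star G {c})))"
    by (simp add: sum_distrib_left)
  also have "\<dots> \<le> (\<Sum>c\<in>C. real (card G))"
    using power_mult_card_fam_star_le[of "{c}" for c] by (intro sum_mono) simp
  finally show ?thesis
    by simp
qed

lemma ex_member_card_Int_le:
  assumes "finite C"
  shows "\<exists>A\<in>G. real (card (A \<inter> C)) \<le> real (card C) / r"
proof (rule ccontr)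
  assume "\<not> ?thesis"
  then have "real (card C) / r < real (card (A \<inter> C))" if "A \<in> G" for A
    using that by (meson not_le)
  then have "(\<Sum>A\<in>G. real (card C) / r) < (\<Sum>A\<in>G. real (card (A \<inter> C)))"
    using finite_family family_nonempty by (intro sum_strict_mono) auto
  then show False
    using sum_card_Int_le[OF assms] ratio_gt_1 by (simp add: field_simps)
qed

lemma card_le_twice_card_disjoint:
  assumes "finite C" "real (card C) \<le> r / 2"
  shows "real (card G) \<le> 2 * real (card {A\<in>G. A \<inter> C = {}})"
proof -
  let ?M = "{A\<in>G. A \<inter> C \<noteq> {}}"
  have "1 \<le> card (A \<inter> C)" if "A \<in> ?M" for A
    using that assms(1) by (simp add: Suc_le_eq card_gt_0_iff)
  then have "real (card ?M) \<le> (\<Sum>A\<in>?M. real (card (A \<inter> C)))"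
    using sum_mono[of ?M "\<lambda>_. 1" "\<lambda>A. real (card (A \<inter> C))"] by fastforce
  also have "\<dots> \<le> (\<Sum>A\<in>G. real (card (A \<inter> C)))"
    using finite_family by (intro sum_mono2) auto
  finally have "r * real (card ?M) \<le> r * (\<Sum>A\<in>G. real (card (A \<inter> C)))"
    using ratio_gt_1 by simp
  also have "\<dots> \<le> real (card C) * real (card G)"
    by (rule sum_card_Int_le[OF assms(1)])
  also have "\<dots> \<le> r / 2 * real (card G)"
    using assms(2) by (rule mult_right_mono) simp
  finally have "2 * real (card ?M) \<le> real (card G)"
    using ratio_gt_1 by (simp add: field_simps)
  moreover have "card G = card ?M + card {A\<in>G. A \<inter> C = {}}"
    using finite_family by (subst card_Un_disjoint[symmetric]) (auto intro: arg_cong[where f=card])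
  ultimately show ?thesis
    by simp
qed

end

section \<open>Fragments\<close>

lemma sum_Pow_power_card:
  fixes x y :: "'b::comm_semiring_1"
  assumes "finite A"
  shows "(\<Sum>B\<in>Pow A. x ^ card B * y ^ card (A - B)) = (x + y) ^ card A"
  using prod_add[OF assms, of "\<lambda>_. x" "\<lambda>_. y"] by simp

lemma sum_Pow_power_card_Diff:
  fixes q :: "'b::comm_semiring_1"
  assumes "finite A"
  shows "(\<Sum>B\<in>Pow A. q ^ card (A - B)) = (1 + q) ^ card A"
  using sum_Pow_power_card[OF assms, of 1 q] by simp

lemma sum_Pow_Un_split:
  fixes x y :: "'b::comm_semiring_1"
  assumes "finite U"
  shows "(\<Sum>W\<in>Pow U. \<Sum>W'\<in>Pow (U - W). x ^ card W * y ^ card W' * f (W \<union> W'))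
    = (\<Sum>Z\<in>Pow U. (x + y) ^ card Z * f Z)"
proof -
  have "(\<Sum>W\<in>Pow U. \<Sum>W'\<in>Pow (U - W). x ^ card W * y ^ card W' * f (W \<union> W'))
    = (\<Sum>(W, W')\<in>Sigma (Pow U) (\<lambda>W. Pow (U - W)). x ^ card W * y ^ card W' * f (W \<union> W'))"
    using assms by (simp add: sum.Sigma)
  also have "\<dots> = (\<Sum>(Z, W)\<in>Sigma (Pow U) Pow. x ^ card W * y ^ card (Z - W) * f Z)"
  proof (rule sum.reindex_bij_witness[where i = "\<lambda>(Z, W). (W, Z - W)" and j = "\<lambda>(W, W'). (W \<union> W', W)"])
    fix p assume "p \<in> Sigma (Pow U) (\<lambda>W. Pow (U - W))"
    then obtain W W' where pair: "p = (W, W')" "W \<subseteq> U" "W' \<subseteq> U - W"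
      by blast
    then have "W \<union> W' - W = W'"
      by blast
    with pair show "(case case p of (W, W') \<Rightarrow> (W \<union> W', W) of (Z, W) \<Rightarrow> (W, Z - W)) = p"
      and "(case case p of (W, W') \<Rightarrow> (W \<union> W', W) of (Z, W) \<Rightarrow> x ^ card W * y ^ card (Z - W) * f Z)
        = (case p of (W, W') \<Rightarrow> x ^ card W * y ^ card W' * f (W \<union> W'))"
      and "(case p of (W, W') \<Rightarrow> (W \<union> W', W)) \<in> Sigma (Pow U) Pow"
      by auto
  qed auto
  also have "\<dots> = (\<Sum>Z\<in>Pow U. \<Sum>W\<in>Pow Z. x ^ card W * y ^ card (Z - W) * f Z)"
    using assms by (subst sum.Sigma) (auto intro: finite_subset)
  also have "\<dots> = (\<Sum>Z\<in>Pow U. (x + y) ^ card Z * f Z)"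
    using assms
    by (intro sum.cong) (auto simp: sum_Pow_power_card finite_subset simp flip: sum_distrib_right)
  finally show ?thesis .
qed

lemma le_mult_double_power:
  fixes x y z \<rho> :: real
  assumes "0 \<le> \<rho>" "0 \<le> z" "x \<le> y * \<rho> ^ j" "y \<le> 2 * z" "x \<le> z"
  shows "x \<le> z * (2 * \<rho>) ^ j"
proof (cases "j = 0")
  case False
  have "2 * z \<le> 2 ^ j * z"
    using self_le_power[of "2::real" j] False assms(2) by (intro mult_right_mono) auto
  then have "y * \<rho> ^ j \<le> (2 ^ j * z) * \<rho> ^ j"
    using assms(1,4) by (intro mult_right_mono) auto
  then show ?thesis
    using assms(3) by (simp add: power_mult_distrib mult_ac)
qed (use assms(5) in simp)

locale bounded_spread_system =
  fixes V :: "'a set" and I :: "'i set" and X :: "'i \<Rightarrow> 'a set" and k :: nat and \<rho> :: real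
  assumes finite_ground: "finite V" and finite_index: "finite I"
    and member_subset: "i \<in> I \<Longrightarrow> X i \<subseteq> V" and card_member_le: "i \<in> I \<Longrightarrow> card (X i) \<le> k"
    and \<rho>_nonneg: "0 \<le> \<rho>"
    and card_containing_le: "real (card {i\<in>I. Y \<subseteq> X i}) \<le> real (card I) * \<rho> ^ card Y"
begin

definition fragment_index :: "'a set \<Rightarrow> 'i \<Rightarrow> 'i" where
  "fragment_index W i = (ARG_MIN (\<lambda>j. card (X j - W)) j. j \<in> I \<and> X j \<subseteq> W \<union> X i)"

definition fragment :: "'a set \<Rightarrow> 'i \<Rightarrow> 'a set" where
  "fragment W i = X (fragment_index W i) - W"

definition avoiding :: "'a set set" where
  "avoiding = {W\<in>Pow V. \<forall>i\<in>I. \<not> X i \<subseteq> W}"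

lemma finite_member: "i \<in> I \<Longrightarrow> finite (X i)"
  using member_subset finite_ground finite_subset by blast

context
  fixes i
  assumes index: "i \<in> I"
begin

lemma fragment_index_in: "fragment_index W i \<in> I"
  and fragment_index_subset: "X (fragment_index W i) \<subseteq> W \<union> X i"
  and card_fragment_le: "j \<in> I \<Longrightarrow> X j \<subseteq> W \<union> X i \<Longrightarrow> card (fragment W i) \<le> card (X j - W)"
  using arg_min_nat_lemma[of "\<lambda>j. j \<in> I \<and> X j \<subseteq> W \<union> X i" i "\<lambda>j. card (X j - W)"] index
  by (auto simp: fragment_index_def fragment_def)

lemma fragment_subset: "fragment W i \<subseteq> X i - W"
  using fragment_index_subset by (auto simp: fragment_def)

lemma finite_fragment: "finite (fragment W i)"
  using finite_member[OF index] fragment_subset finite_subset by blast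

lemma ex_member_subset_Un_fragment: "\<exists>j\<in>I. X j \<subseteq> W \<union> fragment W i"
  using fragment_index_in[of W] by (auto simp: fragment_def)

lemma fragment_subset_member:
  assumes "j \<in> I" "X j \<subseteq> W \<union> fragment W i"
  shows "fragment W i \<subseteq> X j"
proof -
  have "X j \<subseteq> W \<union> X i"
    using assms(2) fragment_subset[of W] by blast
  then have "card (fragment W i) \<le> card (X j - W)"
    by (rule card_fragment_le[OF assms(1)])
  moreover have "X j - W \<subseteq> fragment W i"
    using assms(2) by blast
  ultimately have "X j - W = fragment W i"
    using finite_fragment by (simp add: card_seteq)
  then show ?thesis
    by blast
qed

end

lemma sum_fragment_le_sum_Pow:
  fixes f :: "'a set \<Rightarrow> 'a set \<Rightarrow> real"
  assumes nonneg: "\<And>Z T. 0 \<le> f Z T" and S_subset: "\<And>Z. S Z \<subseteq> V"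
    and fragment_in: "\<And>W i. W \<subseteq> V \<Longrightarrow> i \<in> I \<Longrightarrow> fragment W i \<subseteq> S (W \<union> fragment W i)"
  shows "(\<Sum>W\<in>Pow V. \<Sum>i\<in>I. f (W \<union> fragment W i) (fragment W i))
    \<le> (\<Sum>Z\<in>Pow V. \<Sum>T\<in>Pow (S Z). real (card {i\<in>I. T \<subseteq> X i}) * f Z T)"
proof -
  define code where "code = (\<lambda>(W, i). (W \<union> fragment W i, fragment W i, i))"
  define D where "D = Sigma (Pow V) (\<lambda>Z. Sigma (Pow (S Z)) (\<lambda>T. {i\<in>I. T \<subseteq> X i}))"
  have fin_S: "finite (S Z)" for Z
    using S_subset finite_ground finite_subset by blast
  have inj: "inj_on code (Pow V \<times> I)"
  proof (rule inj_on_inverseI)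
    fix p assume "p \<in> Pow V \<times> I"
    then obtain W i where pair: "p = (W, i)" "i \<in> I"
      by blast
    have "W \<union> fragment W i - fragment W i = W"
      using fragment_subset[OF pair(2), of W] by blast
    then show "(\<lambda>(Z, T, i). (Z - T, i)) (code p) = p"
      by (simp add: pair(1) code_def)
  qed
  have "code (W, i) \<in> D" if "W \<subseteq> V" "i \<in> I" for W i
    using that fragment_in[OF that] fragment_subset[OF that(2), of W] member_subset[OF that(2)]
    unfolding code_def D_def by auto
  then have "code ` (Pow V \<times> I) \<subseteq> D"
    by auto
  moreover have "finite D"
    using finite_ground finite_index fin_S by (auto simp: D_def)
  ultimately have "(\<Sum>(Z, T, i)\<in>code ` (Pow V \<times> I). f Z T) \<le> (\<Sum>(Z, T, i)\<in>D. f Z T)"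
    using nonneg by (intro sum_mono2) auto
  also have "(\<Sum>(Z, T, i)\<in>code ` (Pow V \<times> I). f Z T)
      = (\<Sum>W\<in>Pow V. \<Sum>i\<in>I. f (W \<union> fragment W i) (fragment W i))"
    by (subst sum.reindex[OF inj]) (simp add: code_def case_prod_unfold sum.cartesian_product)
  also have "(\<Sum>(Z, T, i)\<in>D. f Z T) = (\<Sum>Z\<in>Pow V. \<Sum>T\<in>Pow (S Z). real (card {i\<in>I. T \<subseteq> X i}) * f Z T)"
    unfolding D_def using finite_ground finite_index fin_S by (simp add: sum.Sigma[symmetric])
  finally show ?thesis .
qed

text \<open>\<open>W\<close> and its fragment are determined by their union \<open>Z\<close> and a subset of one fixed member
  contained in \<open>Z\<close>.\<close>

lemma ex_set_containing_fragments:
  "\<exists>S\<subseteq>V. card S \<le> k \<and> (\<forall>W. \<forall>i\<in>I. W \<union> fragment W i = Z \<longrightarrow> fragment W i \<subseteq> S)"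
proof (cases "\<exists>j\<in>I. X j \<subseteq> Z")
  case True
  then obtain j where inside: "j \<in> I" "X j \<subseteq> Z"
    by blast
  then have "fragment W i \<subseteq> X j" if "i \<in> I" "W \<union> fragment W i = Z" for W i
    using fragment_subset_member[OF that(1) inside(1)] that(2) by blast
  then show ?thesis
    using member_subset[OF inside(1)] card_member_le[OF inside(1)] by (intro exI[of _ "X j"]) simp
next
  case False
  then have "W \<union> fragment W i \<noteq> Z" if "i \<in> I" for W i
    using ex_member_subset_Un_fragment[OF that] by blast
  then show ?thesis
    by (intro exI[of _ "{}"]) auto
qed

lemma card_Diff_eq_add_fragment:
  assumes "i \<in> I"
  shows "card (V - W) = card (V - (W \<union> fragment W i)) + card (fragment W i)"
proof -
  have "fragment W i \<subseteq> V - W"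
    using fragment_subset[OF assms] member_subset[OF assms] by blast
  then have "card (V - W - fragment W i) + card (fragment W i) = card (V - W)"
    using finite_ground finite_fragment[OF assms] by (simp add: card_Diff_subset card_mono)
  moreover have "V - (W \<union> fragment W i) = V - W - fragment W i"
    by blast
  ultimately show ?thesis
    by simp
qed

text \<open>The weight \<open>q ^ card (V - W)\<close> stands for a random set containing each point of \<open>V\<close> with
  probability \<open>1 / (1 + q)\<close>.\<close>

lemma sum_power_card_fragment_le:
  assumes "0 < q" "0 \<le> \<mu>"
  shows "(\<Sum>W\<in>Pow V. q ^ card (V - W) * (\<Sum>i\<in>I. \<mu> ^ card (fragment W i)))
    \<le> (1 + q * \<mu> * \<rho>) ^ k * real (card I) * (1 + q) ^ card V"
proof -
  define f where "f Z T = q ^ card (V - Z) * (q * \<mu>) ^ card T" for Z T :: "'a set"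
  have f_nonneg: "0 \<le> f Z T" for Z T
    using assms by (simp add: f_def)
  obtain S where container: "\<And>Z. S Z \<subseteq> V" "\<And>Z. card (S Z) \<le> k"
    and fragment_in: "\<And>W i. i \<in> I \<Longrightarrow> fragment W i \<subseteq> S (W \<union> fragment W i)"
    using ex_set_containing_fragments by metis
  have "q ^ card (V - W) * \<mu> ^ card (fragment W i) = f (W \<union> fragment W i) (fragment W i)"
    if "i \<in> I" for W i
    unfolding card_Diff_eq_add_fragment[OF that, of W]
    by (simp add: f_def power_add power_mult_distrib)
  then have "(\<Sum>W\<in>Pow V. q ^ card (V - W) * (\<Sum>i\<in>I. \<mu> ^ card (fragment W i)))
      = (\<Sum>W\<in>Pow V. \<Sum>i\<in>I. f (W \<union> fragment W i) (fragment W i))"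
    by (simp add: sum_distrib_left)
  also have "\<dots> \<le> (\<Sum>Z\<in>Pow V. \<Sum>T\<in>Pow (S Z). real (card {i\<in>I. T \<subseteq> X i}) * f Z T)"
    by (intro sum_fragment_le_sum_Pow f_nonneg container(1) fragment_in)
  also have "\<dots> \<le> (\<Sum>Z\<in>Pow V. \<Sum>T\<in>Pow (S Z). (real (card I) * \<rho> ^ card T) * f Z T)"
    by (intro sum_mono mult_right_mono card_containing_le f_nonneg)
  also have "\<dots> = (\<Sum>Z\<in>Pow V. real (card I) * q ^ card (V - Z) * (1 + q * \<mu> * \<rho>) ^ card (S Z))"
  proof (rule sum.cong)
    fix Z
    have "(1 + q * \<mu> * \<rho>) ^ card (S Z) = (\<Sum>T\<in>Pow (S Z). (q * \<mu> * \<rho>) ^ card T)"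
      using sum_Pow_power_card[of "S Z" "q * \<mu> * \<rho>" 1] finite_subset[OF container(1) finite_ground]
      by (simp add: add.commute)
    then show "(\<Sum>T\<in>Pow (S Z). (real (card I) * \<rho> ^ card T) * f Z T)
        = real (card I) * q ^ card (V - Z) * (1 + q * \<mu> * \<rho>) ^ card (S Z)"
      by (simp add: f_def sum_distrib_left power_mult_distrib mult_ac)
  qed simp
  also have "\<dots> \<le> (\<Sum>Z\<in>Pow V. real (card I) * q ^ card (V - Z) * (1 + q * \<mu> * \<rho>) ^ k)"
    using assms \<rho>_nonneg container(2) by (intro sum_mono mult_left_mono power_increasing) auto
  also have "\<dots> = (1 + q * \<mu> * \<rho>) ^ k * real (card I) * (\<Sum>Z\<in>Pow V. q ^ card (V - Z))"
    by (simp add: sum_distrib_left mult_ac)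
  also have "(\<Sum>Z\<in>Pow V. q ^ card (V - Z)) = (1 + q) ^ card V"
    by (rule sum_Pow_power_card_Diff[OF finite_ground])
  finally show ?thesis .
qed

lemma weight_large_fragments_le:
  assumes "I \<noteq> {}" "0 < q" "1 \<le> \<mu>"
  shows "\<mu> ^ h * (\<Sum>W\<in>{W\<in>Pow V. card I \<le> 2 * card {i\<in>I. h \<le> card (fragment W i)}}. q ^ card (V - W))
    \<le> 2 * (1 + q * \<mu> * \<rho>) ^ k * (1 + q) ^ card V"
    (is "_ * sum ?w ?B \<le> _")
proof -
  have "real (card I) * \<mu> ^ h \<le> 2 * (\<Sum>i\<in>I. \<mu> ^ card (fragment W i))" if "W \<in> ?B" for W
  proof -
    let ?L = "{i\<in>I. h \<le> card (fragment W i)}"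
    have "real (card I) \<le> 2 * real (card ?L)"
      using that by (simp flip: of_nat_le_iff)
    then have "real (card I) * \<mu> ^ h \<le> 2 * real (card ?L) * \<mu> ^ h"
      using assms(3) by (intro mult_right_mono) auto
    also have "\<dots> = 2 * (\<Sum>i\<in>?L. \<mu> ^ h)"
      by simp
    also have "(\<Sum>i\<in>?L. \<mu> ^ h) \<le> (\<Sum>i\<in>?L. \<mu> ^ card (fragment W i))"
      using assms(3) by (intro sum_mono power_increasing) auto
    also have "\<dots> \<le> (\<Sum>i\<in>I. \<mu> ^ card (fragment W i))"
      using finite_index assms(3) by (intro sum_mono2) auto
    finally show ?thesis
      by simp
  qed
  then have "(\<Sum>W\<in>?B. ?w W * (real (card I) * \<mu> ^ h))
      \<le> (\<Sum>W\<in>?B. ?w W * (2 * (\<Sum>i\<in>I. \<mu> ^ card (fragment W i))))"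
    using assms(2) by (intro sum_mono mult_left_mono) auto
  also have "\<dots> \<le> (\<Sum>W\<in>Pow V. ?w W * (2 * (\<Sum>i\<in>I. \<mu> ^ card (fragment W i))))"
    using finite_ground assms(2,3) by (intro sum_mono2) (auto intro!: mult_nonneg_nonneg sum_nonneg)
  also have "\<dots> = 2 * (\<Sum>W\<in>Pow V. ?w W * (\<Sum>i\<in>I. \<mu> ^ card (fragment W i)))"
    by (simp add: sum_distrib_left mult_ac)
  also have "\<dots> \<le> 2 * ((1 + q * \<mu> * \<rho>) ^ k * real (card I) * (1 + q) ^ card V)"
    using assms(2,3) by (intro mult_left_mono sum_power_card_fragment_le) auto
  finally have "real (card I) * (\<mu> ^ h * sum ?w ?B)
      \<le> real (card I) * (2 * (1 + q * \<mu> * \<rho>) ^ k * (1 + q) ^ card V)"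
    by (simp add: sum_distrib_left mult_ac)
  then show ?thesis
    using assms(1) finite_index by (simp add: card_gt_0_iff)
qed

lemma weight_avoiding_le:
  assumes "I \<noteq> {}" "0 < q" "1 \<le> \<mu>"
  shows "\<mu> * (\<Sum>W\<in>avoiding. q ^ card (V - W)) \<le> 2 * (1 + q * \<mu> * \<rho>) ^ k * (1 + q) ^ card V"
proof -
  let ?B = "{W\<in>Pow V. card I \<le> 2 * card {i\<in>I. 1 \<le> card (fragment W i)}}"
  have "avoiding \<subseteq> ?B"
  proof
    fix W assume avoids: "W \<in> avoiding"
    have "1 \<le> card (fragment W i)" if "i \<in> I" for i
    proof -
      have "fragment W i \<noteq> {}"
        using avoids ex_member_subset_Un_fragment[OF that, of W] by (auto simp: avoiding_def)
      then show ?thesis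
        using finite_fragment[OF that] by (simp add: Suc_le_eq card_gt_0_iff)
    qed
    then have "{i\<in>I. 1 \<le> card (fragment W i)} = I"
      by blast
    then show "W \<in> ?B"
      using avoids by (simp add: avoiding_def)
  qed
  then have "(\<Sum>W\<in>avoiding. q ^ card (V - W)) \<le> (\<Sum>W\<in>?B. q ^ card (V - W))"
    using finite_ground assms(2) by (intro sum_mono2) auto
  then have "\<mu> * (\<Sum>W\<in>avoiding. q ^ card (V - W)) \<le> \<mu> ^ 1 * (\<Sum>W\<in>?B. q ^ card (V - W))"
    using assms(3) by simp
  also have "\<dots> \<le> 2 * (1 + q * \<mu> * \<rho>) ^ k * (1 + q) ^ card V"
    by (rule weight_large_fragments_le[OF assms])
  finally show ?thesis .
qed

lemma bounded_spread_system_small_fragments: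
  assumes "card I \<le> 2 * card {i\<in>I. card (fragment W i) < h}"
  shows "bounded_spread_system (V - W) {i\<in>I. card (fragment W i) < h} (fragment W) h (2 * \<rho>)"
proof
  let ?I = "{i\<in>I. card (fragment W i) < h}"
  show "finite (V - W)" "finite ?I"
    using finite_ground finite_index by auto
  show "fragment W i \<subseteq> V - W" "card (fragment W i) \<le> h" if "i \<in> ?I" for i
    using that fragment_subset[of i W] member_subset[of i] by auto
  show "0 \<le> 2 * \<rho>"
    using \<rho>_nonneg by simp
  show "real (card {i\<in>?I. Y \<subseteq> fragment W i}) \<le> real (card ?I) * (2 * \<rho>) ^ card Y" for Y
  proof (rule le_mult_double_power[OF \<rho>_nonneg of_nat_0_le_iff])
    have "{i\<in>?I. Y \<subseteq> fragment W i} \<subseteq> {i\<in>I. Y \<subseteq> X i}"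
      using fragment_subset by blast
    then have "card {i\<in>?I. Y \<subseteq> fragment W i} \<le> card {i\<in>I. Y \<subseteq> X i}"
      using finite_index by (simp add: card_mono)
    then show "real (card {i\<in>?I. Y \<subseteq> fragment W i}) \<le> real (card I) * \<rho> ^ card Y"
      using card_containing_le[of Y] by linarith
    show "real (card {i\<in>?I. Y \<subseteq> fragment W i}) \<le> real (card ?I)"
      using finite_index by (auto intro: card_mono)
    show "real (card I) \<le> 2 * real (card ?I)"
      using assms by linarith
  qed
qed

definition extension_weight :: "'a set \<Rightarrow> real" where
  "extension_weight W = (\<Sum>W'\<in>{W'\<in>Pow (V - W). W \<union> W' \<in> avoiding}. 2 ^ card (V - W - W'))"

lemma extension_weight_le: "extension_weight W \<le> 3 ^ card (V - W)"
proof -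
  have "extension_weight W \<le> (\<Sum>W'\<in>Pow (V - W). 2 ^ card (V - W - W'))"
    unfolding extension_weight_def using finite_ground by (intro sum_mono2) auto
  also have "\<dots> = 3 ^ card (V - W)"
    using finite_ground by (subst sum_Pow_power_card_Diff) simp_all
  finally show ?thesis .
qed

lemma extension_weight_small_fragments_le:
  assumes "I \<noteq> {}" and few_large: "\<not> card I \<le> 2 * card {i\<in>I. h \<le> card (fragment W i)}"
    and "(1 + 128 * \<rho>) ^ h \<le> 2"
  shows "8 * extension_weight W \<le> 3 ^ card (V - W)"
proof -
  let ?I = "{i\<in>I. card (fragment W i) < h}"
  have "card I = card ?I + card {i\<in>I. h \<le> card (fragment W i)}"
    using finite_index by (subst card_Un_disjoint[symmetric]) (auto intro!: arg_cong[where f=card])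
  with few_large have card_I: "card I \<le> 2 * card ?I"
    by linarith
  interpret fragments: bounded_spread_system "V - W" ?I "fragment W" h "2 * \<rho>"
    by (rule bounded_spread_system_small_fragments[OF card_I])
  have "?I \<noteq> {}"
    using card_I assms(1) finite_index by (metis card_0_eq card.empty le_zero_eq mult_zero_right)
  have "W' \<in> fragments.avoiding" if "W' \<subseteq> V - W" "W \<union> W' \<in> avoiding" for W'
  proof -
    have "\<not> fragment W i \<subseteq> W'" if "i \<in> I" for i
      using ex_member_subset_Un_fragment[OF that, of W] \<open>W \<union> W' \<in> avoiding\<close>
      unfolding avoiding_def by blast
    then show ?thesis
      using that(1) by (auto simp: fragments.avoiding_def)
  qed
  then have "extension_weight W \<le> (\<Sum>W'\<in>fragments.avoiding. 2 ^ card (V - W - W'))"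
    unfolding extension_weight_def
    using finite_ground by (intro sum_mono2) (auto simp: fragments.avoiding_def)
  moreover have "32 * (\<Sum>W'\<in>fragments.avoiding. (2::real) ^ card (V - W - W'))
      \<le> 2 * (1 + 128 * \<rho>) ^ h * 3 ^ card (V - W)"
    using fragments.weight_avoiding_le[OF \<open>?I \<noteq> {}\<close>, of 2 32] by simp
  moreover have "(1 + 128 * \<rho>) ^ h * 3 ^ card (V - W) \<le> 2 * 3 ^ card (V - W)"
    using assms(3) by (intro mult_right_mono) auto
  ultimately show ?thesis
    by linarith
qed

lemma sum_extension_weight: "(\<Sum>W\<in>Pow V. extension_weight W) = 2 ^ card V * real (card avoiding)"
proof -
  define f where "f Z = (if Z \<in> avoiding then (2::real) ^ card (V - Z) else 0)" for Z
  have "extension_weight W = (\<Sum>W'\<in>Pow (V - W). f (W \<union> W'))" for W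
    using finite_ground
    by (simp add: extension_weight_def f_def sum.inter_filter[symmetric]
        Diff_Un Diff_Diff_Int set_diff_eq)
  then have "(\<Sum>W\<in>Pow V. extension_weight W) = (\<Sum>Z\<in>Pow V. 2 ^ card Z * f Z)"
    using sum_Pow_Un_split[OF finite_ground, of 1 1 f] by simp
  also have "\<dots> = (\<Sum>Z\<in>Pow V. if Z \<in> avoiding then 2 ^ card V else 0)"
  proof (rule sum.cong)
    fix Z assume "Z \<in> Pow V"
    then have "card V = card Z + card (V - Z)"
      using finite_ground by (metis PowD card_Diff_subset card_mono finite_subset le_add_diff_inverse)
    then show "2 ^ card Z * f Z = (if Z \<in> avoiding then 2 ^ card V else 0)"
      by (simp add: f_def power_add)
  qed simp
  also have "\<dots> = 2 ^ card V * real (card avoiding)"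
    using finite_ground by (simp add: sum.If_cases avoiding_def Int_def mult.commute)
  finally show ?thesis .
qed

text \<open>Two rounds of exposure: a random \<open>W\<close> of density 1/4 leaves small fragments, and a random
  \<open>W'\<close> of density 1/3 in the complement contains one of them; \<open>W \<union> W'\<close> is a uniform subset.\<close>

lemma card_avoiding_le:
  assumes "I \<noteq> {}" "16 * (1 + 6 * \<rho>) ^ k \<le> 2 ^ h" "(1 + 128 * \<rho>) ^ h \<le> 2"
  shows "4 * real (card avoiding) \<le> 2 ^ card V"
proof -
  define bad where "bad W \<longleftrightarrow> card I \<le> 2 * card {i\<in>I. h \<le> card (fragment W i)}" for W
  have "8 * extension_weight W \<le> 8 * (if bad W then 3 ^ card (V - W) else 0) + 3 ^ card (V - W)" for W
  proof (cases "bad W")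
    case True
    have "(0::real) \<le> 3 ^ card (V - W)"
      by simp
    then have "8 * extension_weight W \<le> 8 * 3 ^ card (V - W) + 3 ^ card (V - W)"
      using extension_weight_le[of W] by linarith
    then show ?thesis
      using True by simp
  next
    case False
    then show ?thesis
      using extension_weight_small_fragments_le[OF assms(1) _ assms(3)] by (simp add: bad_def)
  qed
  then have "(\<Sum>W\<in>Pow V. 8 * extension_weight W)
      \<le> (\<Sum>W\<in>Pow V. 8 * (if bad W then 3 ^ card (V - W) else 0) + 3 ^ card (V - W))"
    by (rule sum_mono)
  also have "\<dots> = 8 * (\<Sum>W\<in>{W\<in>Pow V. bad W}. 3 ^ card (V - W)) + 4 ^ card V"
    using sum_Pow_power_card_Diff[OF finite_ground, of "3::real"] finite_ground
    by (simp add: sum.distrib sum.inter_filter[symmetric] flip: sum_distrib_left)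
  also have "8 * (\<Sum>W\<in>{W\<in>Pow V. bad W}. (3::real) ^ card (V - W)) \<le> 4 ^ card V"
  proof -
    have "2 ^ h * (\<Sum>W\<in>{W\<in>Pow V. bad W}. 3 ^ card (V - W)) \<le> 2 * (1 + 6 * \<rho>) ^ k * 4 ^ card V"
      using weight_large_fragments_le[OF assms(1), of 3 2 h] by (simp add: bad_def)
    also have "\<dots> \<le> (2 ^ h / 8) * 4 ^ card V"
      using assms(2) by (intro mult_right_mono) auto
    finally show ?thesis
      by simp
  qed
  also have "(4::real) ^ card V = 2 ^ card V * 2 ^ card V"
    by (simp flip: power_mult_distrib)
  finally have "2 ^ card V * (4 * real (card avoiding)) \<le> 2 ^ card V * 2 ^ card V"
    unfolding sum_distrib_left[symmetric] sum_extension_weight by linarith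
  then show ?thesis
    by simp
qed

end

section \<open>Disjoint members of spread families\<close>

lemma one_plus_power_le_exp:
  fixes x :: real
  assumes "0 \<le> x"
  shows "(1 + x) ^ n \<le> exp (real n * x)"
proof -
  have "(1 + x) ^ n \<le> exp x ^ n"
    using assms by (intro power_mono) auto
  then show ?thesis
    by (simp add: exp_of_nat_mult)
qed

lemma ex_fragment_size:
  fixes r :: real
  assumes "5120 \<le> r" "25000 * real k \<le> r\<^sup>2"
  shows "\<exists>h. 16 * (1 + 12 / r) ^ k \<le> 2 ^ h \<and> (1 + 256 / r) ^ h \<le> 2"
proof (intro exI conjI)
  define m where "m = nat \<lceil>24 * real k / r\<rceil>"
  have m_bounds: "24 * real k / r \<le> real m" "real m \<le> 24 * real k / r + 1"
    using assms(1) by (auto simp: m_def real_nat_ceiling_ge)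
  have "(1 + 12 / r) ^ k \<le> exp (real k * (12 / r))"
    using assms(1) by (intro one_plus_power_le_exp) simp
  also have "\<dots> \<le> exp (real m * (1 / 2))"
    using m_bounds(1) by simp
  also have "\<dots> = exp (1 / 2) ^ m"
    by (rule exp_of_nat_mult)
  also have "\<dots> \<le> 2 ^ m"
    by (intro power_mono exp_half_le2) simp
  finally show "16 * (1 + 12 / r) ^ k \<le> 2 ^ (m + 4)"
    by (simp add: power_add)
  have "512 * (24 * real k / r) \<le> r / 2"
    using assms by (simp add: field_simps power2_eq_square)
  then have "512 * real (m + 4) \<le> r"
    using m_bounds(2) assms(1) by simp
  then have "real (m + 4) * (256 / r) \<le> 1 / 2"
    using assms(1) by (simp add: field_simps)
  have "(1 + 256 / r) ^ (m + 4) \<le> exp (real (m + 4) * (256 / r))"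
    using assms(1) by (intro one_plus_power_le_exp) simp
  also have "\<dots> \<le> exp (1 / 2)"
    using \<open>real (m + 4) * (256 / r) \<le> 1 / 2\<close> by simp
  also have "\<dots> \<le> 2"
    by (rule exp_half_le2)
  finally show "(1 + 256 / r) ^ (m + 4) \<le> 2" .
qed

context spread_family
begin

lemma bounded_spread_system_disjoint:
  assumes "finite C" "real (card C) \<le> r / 2" and "\<And>A. A \<in> G \<Longrightarrow> card A \<le> k"
  shows "bounded_spread_system U {A\<in>G. A \<inter> C = {}} (\<lambda>A. A) k (2 / r)"
proof
  let ?I = "{A\<in>G. A \<inter> C = {}}"
  have "real (card {A\<in>?I. Y \<subseteq> A}) \<le> real (card ?I) * (2 * (1 / r)) ^ card Y" for Y
  proof (rule le_mult_double_power)
    have "card {A\<in>?I. Y \<subseteq> A} \<le> card (fam_star G Y)"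
      using finite_family by (intro card_mono) (auto simp: fam_star_def)
    then have "r ^ card Y * real (card {A\<in>?I. Y \<subseteq> A}) \<le> r ^ card Y * real (card (fam_star G Y))"
      using ratio_gt_1 by simp
    then have "r ^ card Y * real (card {A\<in>?I. Y \<subseteq> A}) \<le> real (card G)"
      using power_mult_card_fam_star_le[of Y] by linarith
    then show "real (card {A\<in>?I. Y \<subseteq> A}) \<le> real (card G) * (1 / r) ^ card Y"
      using ratio_gt_1 by (simp add: power_one_over field_simps)
    show "real (card G) \<le> 2 * real (card ?I)"
      by (rule card_le_twice_card_disjoint[OF assms(1,2)])
    show "real (card {A\<in>?I. Y \<subseteq> A}) \<le> real (card ?I)"
      using finite_family by (auto intro: card_mono)
  qed (use ratio_gt_1 in auto)
  then show "real (card {A\<in>?I. Y \<subseteq> A}) \<le> real (card ?I) * (2 / r) ^ card Y" for Y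
    by simp
qed (use finite_ground finite_family subset_Pow ratio_gt_1 assms(3) in auto)

lemma card_sets_without_disjoint_member_le:
  assumes "5120 \<le> r" "25000 * real k \<le> r\<^sup>2" and "\<And>A. A \<in> G \<Longrightarrow> card A \<le> k"
    and "finite C" "real (card C) \<le> r / 2"
  shows "4 * real (card {W\<in>Pow U. \<forall>A\<in>{A\<in>G. A \<inter> C = {}}. \<not> A \<subseteq> W}) \<le> 2 ^ card U"
proof -
  let ?I = "{A\<in>G. A \<inter> C = {}}"
  interpret bounded_spread_system U ?I "\<lambda>A. A" k "2 / r"
    by (rule bounded_spread_system_disjoint[OF assms(4,5,3)])
  have "0 < card G"
    using family_nonempty finite_family by (simp add: card_gt_0_iff)
  then have "0 < card ?I"
    using card_le_twice_card_disjoint[OF assms(4,5)] by linarith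
  then have "?I \<noteq> {}"
    by (metis card_gt_0_iff)
  moreover obtain h where "16 * (1 + 12 / r) ^ k \<le> 2 ^ h" "(1 + 256 / r) ^ h \<le> 2"
    using ex_fragment_size[OF assms(1,2)] by blast
  ultimately have "4 * real (card avoiding) \<le> 2 ^ card U"
    by (intro card_avoiding_le[of h]) simp_all
  then show ?thesis
    by (simp only: avoiding_def)
qed

end

lemma ex_disjoint_if_few_avoiding:
  assumes "finite U"
    and few: "card {W\<in>Pow U. \<forall>A\<in>G. \<not> A \<subseteq> W} + card {W\<in>Pow U. \<forall>A\<in>G'. \<not> A \<subseteq> W} < 2 ^ card U"
      (is "card ?P + card ?P' < _")
  shows "\<exists>A\<in>G. \<exists>A'\<in>G'. A \<inter> A' = {}"
proof (rule ccontr)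
  assume no_pair: "\<not> ?thesis"
  have "Pow U \<subseteq> ?P \<union> (\<lambda>W. U - W) ` ?P'"
  proof
    fix W assume W_in_Pow: "W \<in> Pow U"
    have "U - W \<in> ?P'" if "W \<notin> ?P"
    proof -
      obtain A where A_in_W: "A \<in> G" "A \<subseteq> W"
        using \<open>W \<notin> ?P\<close> W_in_Pow by blast
      have "\<not> A' \<subseteq> U - W" if "A' \<in> G'" for A'
      proof -
        have "A \<inter> A' \<noteq> {}"
          using no_pair A_in_W(1) that by blast
        then show ?thesis
          using A_in_W(2) by blast
      qed
      then show ?thesis
        by blast
    qed
    moreover have "W = U - (U - W)"
      using W_in_Pow by blast
    ultimately show "W \<in> ?P \<union> (\<lambda>W. U - W) ` ?P'"
      by blast
  qed
  then have "card (Pow U) \<le> card (?P \<union> (\<lambda>W. U - W) ` ?P')"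
    using assms(1) by (intro card_mono) auto
  also have "\<dots> \<le> card ?P + card ?P'"
    using card_Un_le[of ?P "(\<lambda>W. U - W) ` ?P'"] card_image_le[of ?P' "\<lambda>W. U - W"] assms(1) by simp
  finally show False
    using few assms(1) by (simp add: card_Pow)
qed

lemma spread_families_disjoint_members:
  assumes "spread_family U G r" "spread_family U G' r"
    and "5120 \<le> r" "25000 * real k \<le> r\<^sup>2" and "\<And>A. A \<in> G \<union> G' \<Longrightarrow> card A \<le> k"
    and "finite C" "real (card C) \<le> r / 2" and "finite C'" "real (card C') \<le> r / 2"
  shows "\<exists>A\<in>G. \<exists>A'\<in>G'. A \<inter> C = {} \<and> A' \<inter> C' = {} \<and> A \<inter> A' = {}"
proof -
  interpret spread_family U G r
    by (rule assms(1))
  define P where "P = {W\<in>Pow U. \<forall>A\<in>{A\<in>G. A \<inter> C = {}}. \<not> A \<subseteq> W}"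
  define P' where "P' = {W\<in>Pow U. \<forall>A\<in>{A\<in>G'. A \<inter> C' = {}}. \<not> A \<subseteq> W}"
  have "4 * real (card P) \<le> 2 ^ card U"
    unfolding P_def by (rule card_sets_without_disjoint_member_le) (use assms(3-7) in auto)
  moreover have "4 * real (card P') \<le> 2 ^ card U"
    unfolding P'_def
    by (rule spread_family.card_sets_without_disjoint_member_le[OF assms(2)]) (use assms(3-9) in auto)
  moreover have "(0::real) < 2 ^ card U"
    by simp
  ultimately have "real (card P) + real (card P') < 2 ^ card U"
    by linarith
  then have "card P + card P' < 2 ^ card U"
    by (metis of_nat_add of_nat_less_iff of_nat_numeral of_nat_power)
  then have "\<exists>A\<in>{A\<in>G. A \<inter> C = {}}. \<exists>A'\<in>{A\<in>G'. A \<inter> C' = {}}. A \<inter> A' = {}"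
    unfolding P_def P'_def by (rule ex_disjoint_if_few_avoiding[OF finite_ground])
  then show ?thesis
    by blast
qed

section \<open>Spread approximation\<close>

definition spread_centers :: "'a set \<Rightarrow> real \<Rightarrow> 'a set set \<Rightarrow> nat \<Rightarrow> 'a set set" where
  "spread_centers U r F w = {B. card B \<le> w \<and> (\<exists>H\<subseteq>F. spread U r (fam_link H B))}"

definition uncovered :: "'a set set \<Rightarrow> 'a set set \<Rightarrow> 'a set set" where
  "uncovered F S = F - fam_stars F S"

context set_family
begin

lemma spread_centerE:
  assumes "B \<in> spread_centers U r G w"
  obtains H where "H \<subseteq> G" "spread_family U (fam_link H B) r"
proof -
  obtain H where spread_H: "H \<subseteq> G" "spread U r (fam_link H B)"
    using assms by (auto simp: spread_centers_def)
  moreover have "fam_link H B \<subseteq> Pow U"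
    using spread_H(1) subset_Pow by (auto simp: fam_link_def)
  ultimately show thesis
    using finite_ground ground_nonempty that
    by (auto intro!: spread_family.intro set_family.intro spread_family_axioms.intro)
qed

lemma fam_linkD:
  assumes "H \<subseteq> G" "A \<in> fam_link H B"
  shows "A \<union> B \<in> G" "finite A" "card A \<le> card (A \<union> B)"
proof -
  have "A \<union> B \<in> H"
    using assms(2) by (auto simp: fam_link_def Un_absorb2)
  then show "A \<union> B \<in> G"
    using assms(1) by blast
  then have "finite (A \<union> B)"
    by (rule finite_member)
  then show "finite A" "card A \<le> card (A \<union> B)"
    by (auto intro: card_mono)
qed

lemma spread_center_subset_member:
  assumes "B \<in> spread_centers U r G w"
  shows "\<exists>A\<in>G. B \<subseteq> A"
proof -
  obtain H where spread_H: "H \<subseteq> G" "spread_family U (fam_link H B) r"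
    by (rule spread_centerE[OF assms])
  from spread_H(2) have "fam_link H B \<noteq> {}"
    by (rule spread_family.family_nonempty)
  then show ?thesis
    using spread_H(1) by (auto simp: fam_link_def)
qed

lemma spread_centers_subset_Pow: "spread_centers U r G w \<subseteq> Pow U"
  using spread_center_subset_member subset_Pow by blast

lemma spread_centers_almost_intersecting:
  assumes "t_intersecting t G" and card_le: "\<And>A. A \<in> G \<Longrightarrow> card A \<le> k"
    and center_B: "B \<in> spread_centers U r G w" and center_B': "B' \<in> spread_centers U r G w"
  shows "real t \<le> real (card (B \<inter> B')) + 2 * real k / r"
proof -
  obtain H where spread_H: "H \<subseteq> G" "spread_family U (fam_link H B) r"
    by (rule spread_centerE[OF center_B])
  obtain H' where spread_H': "H' \<subseteq> G" "spread_family U (fam_link H' B') r"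
    by (rule spread_centerE[OF center_B'])
  have "r > 1"
    by (rule spread_family.ratio_gt_1[OF spread_H(2)])
  have "\<exists>A\<in>G. B \<subseteq> A"
    by (rule spread_center_subset_member[OF center_B])
  then have "finite B" "card B \<le> k"
    using card_le finite_member by (meson card_mono finite_subset order_trans)+
  obtain A' where small_A': "A' \<in> fam_link H' B'" "real (card (A' \<inter> B)) \<le> real (card B) / r"
    using spread_family.ex_member_card_Int_le[OF spread_H'(2) \<open>finite B\<close>] by blast
  note member_A' = fam_linkD[OF spread_H'(1) small_A'(1)]
  obtain A where small_A: "A \<in> fam_link H B"
    "real (card (A \<inter> (A' \<union> B'))) \<le> real (card (A' \<union> B')) / r"
    using spread_family.ex_member_card_Int_le[OF spread_H(2) finite_member[OF member_A'(1)]] by blast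
  note member_A = fam_linkD[OF spread_H(1) small_A(1)]
  have "t \<le> card ((A \<union> B) \<inter> (A' \<union> B'))"
    using assms(1) member_A(1) member_A'(1) by (simp add: t_intersecting_def)
  also have "(A \<union> B) \<inter> (A' \<union> B') = (A \<inter> (A' \<union> B')) \<union> ((A' \<inter> B) \<union> (B \<inter> B'))"
    by blast
  also have "card \<dots> \<le> card (A \<inter> (A' \<union> B')) + (card (A' \<inter> B) + card (B \<inter> B'))"
    by (meson card_Un_le add_left_mono order_trans)
  finally have "real t \<le> real (card (A \<inter> (A' \<union> B'))) + real (card (A' \<inter> B)) + real (card (B \<inter> B'))"
    by linarith
  moreover have "real (card (A' \<union> B')) / r \<le> real k / r" "real (card B) / r \<le> real k / r"
    using card_le[OF member_A'(1)] \<open>card B \<le> k\<close> \<open>r > 1\<close> by (auto intro: divide_right_mono)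
  ultimately show ?thesis
    using small_A(2) small_A'(2) by (simp add: add_divide_distrib)
qed

lemma spread_centers_t_intersecting:
  assumes intersecting: "t_intersecting t G" "\<And>A. A \<in> G \<Longrightarrow> card A \<le> k"
    and ratio: "5120 \<le> r" "25000 * real k \<le> r\<^sup>2" and size: "real w + 2 * real k / r \<le> real t + r / 2"
  shows "t_intersecting t (spread_centers U r G w)"
  unfolding t_intersecting_def
proof (intro ballI)
  fix B B' assume center_B: "B \<in> spread_centers U r G w" and center_B': "B' \<in> spread_centers U r G w"
  obtain H where spread_H: "H \<subseteq> G" "spread_family U (fam_link H B) r"
    by (rule spread_centerE[OF center_B])
  obtain H' where spread_H': "H' \<subseteq> G" "spread_family U (fam_link H' B') r"
    by (rule spread_centerE[OF center_B'])
  have "B \<subseteq> U" "B' \<subseteq> U"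
    using center_B center_B' spread_centers_subset_Pow by blast+
  then have fin: "finite B" "finite B'"
    using finite_ground by (simp_all add: finite_subset)
  have "card B = card (B \<inter> B') + card (B - B')" "card B' = card (B \<inter> B') + card (B' - B)"
    using fin by (metis Int_commute card_Int_Diff)+
  moreover have "card B \<le> w" "card B' \<le> w"
    using center_B center_B' by (auto simp: spread_centers_def)
  ultimately have "real (card (B' - B)) \<le> r / 2" "real (card (B - B')) \<le> r / 2"
    using spread_centers_almost_intersecting[OF intersecting center_B center_B'] size by linarith+
  moreover have "card A \<le> k" if "A \<in> fam_link H B \<union> fam_link H' B'" for A
    using that fam_linkD(1,3)[OF spread_H(1), of A B] fam_linkD(1,3)[OF spread_H'(1), of A B']
      intersecting(2) le_trans by blast
  ultimately obtain A A' where disjoint: "A \<in> fam_link H B" "A' \<in> fam_link H' B'"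
    "A \<inter> (B' - B) = {}" "A' \<inter> (B - B') = {}" "A \<inter> A' = {}"
    using spread_families_disjoint_members[OF spread_H(2) spread_H'(2) ratio, of "B' - B" "B - B'"]
      fin by auto
  have "t \<le> card ((A \<union> B) \<inter> (A' \<union> B'))"
    using intersecting(1) fam_linkD(1)[OF spread_H(1) disjoint(1)]
      fam_linkD(1)[OF spread_H'(1) disjoint(2)] by (simp add: t_intersecting_def)
  also have "(A \<union> B) \<inter> (A' \<union> B') = B \<inter> B'"
  proof -
    have "A \<inter> B = {}" "A' \<inter> B' = {}"
      using disjoint(1,2) by (auto simp: fam_link_def)
    then show ?thesis
      using disjoint(3-5) by blast
  qed
  finally show "t \<le> card (B \<inter> B')" .
qed

lemma fam_star_uncovered:
  assumes "B \<in> S" "D \<subseteq> uncovered G S"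
  shows "fam_star D B = {}"
  using assms by (auto simp: uncovered_def fam_stars_def fam_star_def)

lemma card_uncovered_star_le:
  assumes "r > 1" "0 \<le> X" and uncovered: "D \<subseteq> uncovered G (spread_centers U r G w)"
    and contains: "\<And>A. A \<in> D \<Longrightarrow> T \<subseteq> A"
    and large: "\<And>B. w < card B \<Longrightarrow> fam_star G B \<noteq> {} \<Longrightarrow>
      r ^ (card B - card T) * real (card (fam_star G B)) \<le> X"
  shows "real (card D) \<le> X"
proof (cases "D = {}")
  case False
  have "D \<subseteq> G"
    using uncovered by (auto simp: uncovered_def)
  then have "D \<subseteq> Pow U"
    using subset_Pow by blast
  then obtain B where heavy_B: "heavy r D T B" "spread U r (fam_link D B)"
    using ex_heavy_spread_fam_link[OF finite_ground _ False assms(1) contains] by blast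
  have "0 < card D"
    using False \<open>D \<subseteq> G\<close> finite_family finite_subset by (auto simp: card_gt_0_iff)
  then have "fam_star D B \<noteq> {}"
    using heavy_B(1) by (auto simp: heavy_def)
  then have "B \<notin> spread_centers U r G w"
    using uncovered fam_star_uncovered by blast
  then have "w < card B"
    using heavy_B(2) \<open>D \<subseteq> G\<close> by (auto simp: spread_centers_def)
  have "fam_star D B \<subseteq> fam_star G B"
    using \<open>D \<subseteq> G\<close> by (auto simp: fam_star_def)
  then have "card (fam_star D B) \<le> card (fam_star G B)"
    using finite_family by (auto intro: card_mono finite_subset[OF fam_star_subset])
  then have "r ^ (card B - card T) * real (card (fam_star D B))
      \<le> r ^ (card B - card T) * real (card (fam_star G B))"
    using \<open>r > 1\<close> by simp
  also have "\<dots> \<le> X"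
    using large[OF \<open>w < card B\<close>] \<open>fam_star D B \<subseteq> fam_star G B\<close> \<open>fam_star D B \<noteq> {}\<close> by blast
  finally show ?thesis
    using heavy_B(1) by (simp add: heavy_def)
qed (use assms(2) in simp)

lemma sum_card_uncovered_stars_le:
  assumes "r > 1" "0 \<le> X" and uncovered: "D \<subseteq> uncovered G (spread_centers U r G w')"
    and large: "\<And>B. w' < card B \<Longrightarrow> fam_star G B \<noteq> {} \<Longrightarrow>
      real (w choose u) * (r ^ (card B - u) * real (card (fam_star G B))) \<le> X"
    and "finite A" "card A \<le> w"
  shows "(\<Sum>T\<in>{T. T \<subseteq> A \<and> card T = u}. real (card (fam_star D T))) \<le> X"
proof (cases "w choose u = 0")
  case True
  then have "card T \<noteq> u" if "T \<subseteq> A" for T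
    using card_mono[OF assms(5) that] assms(6) by (simp add: binomial_eq_0_iff)
  then have "{T. T \<subseteq> A \<and> card T = u} = {}"
    by blast
  then show ?thesis
    using assms(2) by (simp only: sum.empty)
next
  case False
  have "real (card (fam_star D T)) \<le> X / real (w choose u)" if "card T = u" for T
  proof (rule card_uncovered_star_le[OF assms(1)])
    show "fam_star D T \<subseteq> uncovered G (spread_centers U r G w')"
      using uncovered fam_star_subset by blast
    show "0 \<le> X / real (w choose u)"
      using assms(2) by simp
    show "T \<subseteq> A" if "A \<in> fam_star D T" for A
      using that by (simp add: fam_star_def)
    show "r ^ (card B - card T) * real (card (fam_star G B)) \<le> X / real (w choose u)"
      if "w' < card B" "fam_star G B \<noteq> {}" for B
      using large[OF that] False \<open>card T = u\<close> by (simp add: field_simps)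
  qed
  then have "(\<Sum>T\<in>{T. T \<subseteq> A \<and> card T = u}. real (card (fam_star D T)))
      \<le> real (card {T. T \<subseteq> A \<and> card T = u}) * (X / real (w choose u))"
    by (intro sum_bounded_above) simp
  also have "\<dots> \<le> real (w choose u) * (X / real (w choose u))"
    using assms(2,5,6) by (intro mult_right_mono) (auto simp: n_subsets binomial_right_mono)
  finally show ?thesis
    using False by simp
qed

lemma subset_uncovered_Un_stars:
  assumes "t_intersecting u S" "A \<in> S" "D \<subseteq> G"
  shows "D \<subseteq> uncovered G S \<union> (\<Union>T\<in>{T. T \<subseteq> A \<and> card T = u}. fam_star D T)"
proof
  fix E assume "E \<in> D"
  show "E \<in> uncovered G S \<union> (\<Union>T\<in>{T. T \<subseteq> A \<and> card T = u}. fam_star D T)"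
  proof (cases "E \<in> uncovered G S")
    case False
    then obtain B where covers_E: "B \<in> S" "B \<subseteq> E"
      using \<open>E \<in> D\<close> assms(3) by (auto simp: uncovered_def fam_stars_def fam_star_def)
    have "u \<le> card (A \<inter> B)"
      using assms(1,2) covers_E(1) by (simp add: t_intersecting_def)
    then obtain T where T_subset: "T \<subseteq> A \<inter> B" "card T = u"
      by (meson obtain_subset_with_card_n)
    then have "E \<in> fam_star D T"
      using \<open>E \<in> D\<close> covers_E(2) by (auto simp: fam_star_def)
    then show ?thesis
      using T_subset by blast
  qed simp
qed

lemma card_uncovered_spread_centers_le:
  assumes "r > 1" "0 \<le> X" and cover: "S \<subseteq> Pow U" "\<And>B. B \<in> S \<Longrightarrow> card B \<le> w" "t_intersecting u S"
    and large: "\<And>B. w' < card B \<Longrightarrow> fam_star G B \<noteq> {} \<Longrightarrow>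
      real (w choose u) * (r ^ (card B - u) * real (card (fam_star G B))) \<le> X"
  shows "real (card (uncovered G (spread_centers U r G w'))) \<le> real (card (uncovered G S)) + X"
proof (cases "S = {}")
  case True
  then have "uncovered G S = G"
    by (simp add: uncovered_def fam_stars_def)
  moreover have "card (uncovered G (spread_centers U r G w')) \<le> card G"
    using finite_family by (auto simp: uncovered_def intro: card_mono)
  ultimately show ?thesis
    using assms(2) by simp
next
  case False
  then obtain A where A_in_cover: "A \<in> S"
    by blast
  define D where "D = uncovered G (spread_centers U r G w')"
  let ?\<T> = "{T. T \<subseteq> A \<and> card T = u}"
  have "finite A"
    using A_in_cover cover(1) finite_ground finite_subset by blast
  have "D \<subseteq> G"
    by (auto simp: D_def uncovered_def)
  then have "finite D" "finite (uncovered G S)"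
    using finite_family finite_subset by (auto simp: uncovered_def)
  then have "card D \<le> card (uncovered G S \<union> (\<Union>T\<in>?\<T>. fam_star D T))"
    using subset_uncovered_Un_stars[OF cover(3) A_in_cover \<open>D \<subseteq> G\<close>] \<open>finite A\<close>
    by (intro card_mono) (auto intro: finite_subset[OF fam_star_subset])
  also have "\<dots> \<le> card (uncovered G S) + card (\<Union>T\<in>?\<T>. fam_star D T)"
    by (rule card_Un_le)
  also have "card (\<Union>T\<in>?\<T>. fam_star D T) \<le> (\<Sum>T\<in>?\<T>. card (fam_star D T))"
    using \<open>finite A\<close> by (intro card_UN_le) simp
  finally have "real (card D) \<le> real (card (uncovered G S)) + (\<Sum>T\<in>?\<T>. real (card (fam_star D T)))"
    by (simp flip: of_nat_sum of_nat_add)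
  also have "(\<Sum>T\<in>?\<T>. real (card (fam_star D T))) \<le> X"
    unfolding D_def
    by (rule sum_card_uncovered_stars_le[OF assms(1,2) order_refl large \<open>finite A\<close>
          cover(2)[OF A_in_cover]])
  finally show ?thesis
    unfolding D_def by simp
qed

lemma uncovered_spread_centers_eq_empty:
  assumes "r > 1" "\<And>A. A \<in> G \<Longrightarrow> card A \<le> w"
  shows "uncovered G (spread_centers U r G w) = {}"
proof -
  have "A \<in> spread_centers U r G w" if "A \<in> G" for A
  proof -
    have "fam_link {A} A = {{}}"
      by (auto simp: fam_link_def)
    then have "spread U r (fam_link {A} A)"
      using spread_singleton_empty[OF assms(1)] by simp
    then show ?thesis
      using that assms(2) unfolding spread_centers_def by blast
  qed
  then show ?thesis
    by (auto simp: uncovered_def fam_stars_def fam_star_def)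
qed

lemma card_uncovered_spread_centers_iterated_le:
  assumes "r > 1" "0 \<le> X" "\<And>A. A \<in> G \<Longrightarrow> card A \<le> k" "\<And>w. t_intersecting u (spread_centers U r G w)"
    and large: "\<And>B. w < card B \<Longrightarrow> fam_star G B \<noteq> {} \<Longrightarrow>
      real (card B choose u) * (r ^ (card B - u) * real (card (fam_star G B))) \<le> X"
  shows "real (card (uncovered G (spread_centers U r G w))) \<le> real (k - w) * X"
  using large
proof (induction "k - w" arbitrary: w)
  case 0
  then have "card A \<le> w" if "A \<in> G" for A
    using assms(3)[OF that] by linarith
  then show ?case
    using assms(2) by (simp add: uncovered_spread_centers_eq_empty[OF assms(1)])
next
  case (Suc d)
  have "real (card (uncovered G (spread_centers U r G w)))
      \<le> real (card (uncovered G (spread_centers U r G (Suc w)))) + X"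
  proof (rule card_uncovered_spread_centers_le[OF assms(1,2) spread_centers_subset_Pow _ assms(4)])
    fix B assume large_B: "w < card B" "fam_star G B \<noteq> {}"
    have "real (Suc w choose u) * (r ^ (card B - u) * real (card (fam_star G B)))
        \<le> real (card B choose u) * (r ^ (card B - u) * real (card (fam_star G B)))"
      using large_B(1) assms(1) by (intro mult_right_mono) (auto intro: binomial_right_mono)
    also have "\<dots> \<le> X"
      by (rule Suc.prems[OF large_B])
    finally show "real (Suc w choose u) * (r ^ (card B - u) * real (card (fam_star G B))) \<le> X" .
  qed (auto simp: spread_centers_def)
  also have "real (card (uncovered G (spread_centers U r G (Suc w)))) \<le> real (k - Suc w) * X"
    using Suc.hyps(2) Suc.prems by (intro Suc.hyps(1)) auto
  also have "real (k - Suc w) * X + X = real (k - w) * X"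
    using Suc.hyps(2) by (simp add: of_nat_diff algebra_simps)
  finally show ?case
    by simp
qed

end

section \<open>Compositions with maximal product\<close>

definition compositions :: "nat \<Rightarrow> nat \<Rightarrow> nat list set" where
  "compositions k n = {xs. length xs = k \<and> (\<forall>x\<in>set xs. 0 < x) \<and> sum_list xs = n}"

lemma finite_compositions: "finite (compositions k n)"
proof (rule finite_subset)
  show "compositions k n \<subseteq> {xs. set xs \<subseteq> {..n} \<and> length xs = k}"
    using member_le_sum_list by (auto simp: compositions_def)
  show "finite {xs. set xs \<subseteq> {..n} \<and> length xs = k}"
    by (rule finite_lists_length_eq) simp
qed

lemma c_max_eq_Max_compositions: "c_max n t = Max (prod_list ` compositions (n - t) n)"
  by (simp add: c_max_def compositions_def image_Collect)

lemma prod_list_le_c_max: "xs \<in> compositions (n - t) n \<Longrightarrow> prod_list xs \<le> c_max n t"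
  unfolding c_max_eq_Max_compositions by (intro Max_ge finite_imageI finite_compositions imageI)

lemma c_max_attained:
  assumes "t < n"
  obtains xs where "xs \<in> compositions (n - t) n" "c_max n t = prod_list xs"
proof -
  have "Suc t # replicate (n - t - 1) 1 \<in> compositions (n - t) n"
    using assms by (auto simp: compositions_def sum_list_replicate)
  then have "prod_list ` compositions (n - t) n \<noteq> {}"
    by blast
  then have "c_max n t \<in> prod_list ` compositions (n - t) n"
    unfolding c_max_eq_Max_compositions by (intro Max_in finite_imageI finite_compositions)
  then show thesis
    using that by blast
qed

lemma prod_le_c_max:
  assumes "finite R" "\<And>x. x \<in> R \<Longrightarrow> 0 < f x" "card R = n - t" "sum f R = n"
  shows "prod f R \<le> c_max n t"
proof -
  obtain xs where xs: "set xs = R" "distinct xs"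
    using finite_distinct_list[OF assms(1)] by blast
  then have "map f xs \<in> compositions (n - t) n"
    using assms
    by (auto simp: compositions_def sum_list_distinct_conv_sum_set simp flip: distinct_card)
  then have "prod_list (map f xs) \<le> c_max n t"
    by (rule prod_list_le_c_max)
  then show ?thesis
    using prod.distinct_set_conv_list[OF xs(2), of f] xs(1) by simp
qed

lemma c_max_Suc_le:
  assumes "Suc t < n"
  shows "c_max n (Suc t) \<le> 2 * c_max n t"
proof -
  obtain xs where maximal: "xs \<in> compositions (n - Suc t) n" "c_max n (Suc t) = prod_list xs"
    using c_max_attained[OF assms] .
  have "\<exists>x\<in>set xs. 2 \<le> x"
  proof (rule ccontr)
    assume "\<not> ?thesis"
    then have "\<forall>x\<in>set xs. x = 1"
      using maximal(1) by (force simp: compositions_def)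
    then have "sum_list xs = length xs"
      by (induction xs) auto
    moreover have "length xs = n - Suc t" "sum_list xs = n"
      using maximal(1) by (simp_all add: compositions_def)
    ultimately show False
      using assms by linarith
  qed
  then obtain ys x zs where split: "xs = ys @ x # zs" "2 \<le> x"
    by (meson split_list)
  let ?ws = "ys @ 1 # (x - 1) # zs"
  have "?ws \<in> compositions (n - t) n"
    using maximal(1) split assms by (auto simp: compositions_def)
  then have "prod_list ?ws \<le> c_max n t"
    by (rule prod_list_le_c_max)
  have "prod_list xs = (prod_list ys * prod_list zs) * x"
    by (simp add: split(1))
  also have "\<dots> \<le> (prod_list ys * prod_list zs) * (2 * (x - 1))"
    using split(2) by (intro mult_left_mono) auto
  also have "\<dots> = 2 * prod_list ?ws"
    by simp
  finally show ?thesis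
    using maximal(2) \<open>prod_list ?ws \<le> c_max n t\<close> by linarith
qed

lemma c_max_add_le: "t + b < n \<Longrightarrow> c_max n (t + b) \<le> 2 ^ b * c_max n t"
proof (induction b)
  case (Suc b)
  have "c_max n (t + Suc b) \<le> 2 * c_max n (t + b)"
    using c_max_Suc_le[of "t + b" n] Suc.prems by simp
  also have "\<dots> \<le> 2 * (2 ^ b * c_max n t)"
    using Suc by (intro mult_left_mono) auto
  finally show ?case
    by simp
qed simp

section \<open>Components of edge sets\<close>

abbreviation adjacent :: "'v set set \<Rightarrow> 'v \<Rightarrow> 'v \<Rightarrow> bool" where
  "adjacent E x y \<equiv> {x, y} \<in> E"

abbreviation reachable :: "'v set set \<Rightarrow> 'v \<Rightarrow> 'v \<Rightarrow> bool" where
  "reachable E \<equiv> (adjacent E)\<^sup>*\<^sup>*"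

lemma reachable_sym: "reachable E x y \<Longrightarrow> reachable E y x"
proof -
  have "symp (adjacent E)"
    by (simp add: symp_def insert_commute)
  then show "reachable E x y \<Longrightarrow> reachable E y x"
    by (meson symp_rtranclp sympD)
qed

lemma reachable_mono: "E \<subseteq> F \<Longrightarrow> reachable E x y \<Longrightarrow> reachable F x y"
  using rtranclp_mono[of "adjacent E" "adjacent F"] by (auto simp: le_fun_def)

lemma connects_iff_reachable: "connects E V \<longleftrightarrow> (\<forall>u\<in>V. \<forall>v\<in>V. reachable E u v)"
  by (simp add: connects_def rtranclp_rtrancl_eq)

lemma acyclic_edge_separates:
  assumes "\<nexists>vs. is_cycle E vs" "{x, y} \<in> E" "x \<noteq> y"
  shows "\<not> reachable (E - {{x, y}}) x y"
proof
  assume "reachable (E - {{x, y}}) x y"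
  then obtain vs where path: "rtrancl_path (adjacent (E - {{x, y}})) x vs y" and "distinct (x # vs)"
    by (metis rtranclp_eq_rtrancl_path rtrancl_path_distinct)
  have last: "vs \<noteq> []" "last vs = y"
    using path \<open>x \<noteq> y\<close> by (auto elim: rtrancl_path.cases dest: rtrancl_path_last)
  have edge: "{(x # vs) ! i, vs ! i} \<in> E - {{x, y}}" if "i < length vs" for i
    using rtrancl_path_nth[OF path that] .
  have "2 \<le> length vs"
  proof (rule ccontr)
    assume "\<not> ?thesis"
    then have "length vs = 1"
      using last(1) by (cases vs) (auto simp: not_le)
    then have "vs = [y]"
      using last(2) by (auto simp: length_Suc_conv)
    then show False
      using edge[of 0] by simp
  qed
  moreover have "{(x # vs) ! i, (x # vs) ! (Suc i mod length (x # vs))} \<in> E" if "i \<le> length vs" for i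
  proof (cases "i < length vs")
    case True
    then show ?thesis
      using edge by simp
  next
    case False
    then have "i = length vs"
      using that by simp
    then have "(x # vs) ! i = y"
      using last by (simp add: last_conv_nth nth_Cons')
    then show ?thesis
      using \<open>i = length vs\<close> assms(2) by (simp add: insert_commute)
  qed
  ultimately have "is_cycle E (x # vs)"
    using \<open>distinct (x # vs)\<close> by (simp add: is_cycle_def less_Suc_eq_le)
  then show False
    using assms(1) by blast
qed

definition comp_root :: "'v::wellorder set set \<Rightarrow> 'v \<Rightarrow> 'v" where
  "comp_root E v = (LEAST w. reachable E v w)"

definition root_dist :: "'v::wellorder set set \<Rightarrow> 'v \<Rightarrow> nat" where
  "root_dist E v = (LEAST k. (adjacent E ^^ k) v (comp_root E v))"

definition parent :: "'v::wellorder set set \<Rightarrow> 'v \<Rightarrow> 'v" where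
  "parent E v = (SOME p. {v, p} \<in> E \<and> root_dist E p < root_dist E v \<and> comp_root E p = comp_root E v)"

lemma reachable_comp_root: "reachable E v (comp_root E v)"
  unfolding comp_root_def by (rule LeastI[of _ v]) simp

lemma comp_root_le: "reachable E v w \<Longrightarrow> comp_root E v \<le> w"
  unfolding comp_root_def by (rule Least_le)

lemma comp_root_eq:
  assumes "reachable E v w"
  shows "comp_root E v = comp_root E w"
proof -
  have "reachable E v u \<longleftrightarrow> reachable E w u" for u
    using assms reachable_sym[OF assms] by (meson rtranclp_trans)
  then show ?thesis
    by (simp add: comp_root_def)
qed

lemma comp_root_idem: "comp_root E (comp_root E v) = comp_root E v"
  using comp_root_eq[OF reachable_comp_root, of E v] by simp

lemma ex_parent:
  assumes "comp_root E v \<noteq> v"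
  shows "\<exists>p. {v, p} \<in> E \<and> root_dist E p < root_dist E v \<and> comp_root E p = comp_root E v"
proof -
  obtain k where "(adjacent E ^^ k) v (comp_root E v)"
    using reachable_comp_root rtranclp_power by metis
  then have path: "(adjacent E ^^ root_dist E v) v (comp_root E v)"
    unfolding root_dist_def by (rule LeastI)
  then obtain d where dist: "root_dist E v = Suc d"
    using assms by (cases "root_dist E v") auto
  obtain p where step: "{v, p} \<in> E" "(adjacent E ^^ d) p (comp_root E v)"
    using relpowp_Suc_D2[OF path[unfolded dist]] by blast
  have "comp_root E v = comp_root E p"
    using step(1) by (intro comp_root_eq) auto
  moreover from this step(2) have "root_dist E p \<le> d"
    unfolding root_dist_def by (simp add: Least_le)
  ultimately show ?thesis
    using step(1) dist by (intro exI[of _ p]) simp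
qed

lemma
  assumes "comp_root E v \<noteq> v"
  shows parent_edge: "{v, parent E v} \<in> E"
    and root_dist_parent_less: "root_dist E (parent E v) < root_dist E v"
    and comp_root_parent: "comp_root E (parent E v) = comp_root E v"
  using someI_ex[OF ex_parent[OF assms]] unfolding parent_def by auto

lemma inj_on_parent_edge: "inj_on (\<lambda>v. {v, parent E v}) {v. comp_root E v \<noteq> v}"
proof (rule inj_onI, rule ccontr)
  fix v w assume vw: "v \<in> {v. comp_root E v \<noteq> v}" "w \<in> {v. comp_root E v \<noteq> v}"
    "{v, parent E v} = {w, parent E w}" "v \<noteq> w"
  then have "parent E v = w" "parent E w = v"
    by (auto simp: doubleton_eq_iff)
  then show False
    using root_dist_parent_less[of E v] root_dist_parent_less[of E w] vw(1,2) by simp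
qed

section \<open>Spanning trees containing a forest\<close>

definition roots :: "nat \<Rightarrow> nat set set \<Rightarrow> nat set" where
  "roots n E = {v\<in>{1..n}. comp_root E v = v}"

definition component :: "nat \<Rightarrow> nat set set \<Rightarrow> nat \<Rightarrow> nat set" where
  "component n E \<rho> = {v\<in>{1..n}. comp_root E v = \<rho>}"

lemma finite_roots: "finite (roots n E)"
  by (simp add: roots_def)

lemma finite_component: "finite (component n E \<rho>)"
  by (simp add: component_def)

lemma root_in_component: "\<rho> \<in> roots n E \<Longrightarrow> \<rho> \<in> component n E \<rho>"
  by (auto simp: roots_def component_def)

lemma finite_K_edges: "finite (K_edges n)"
  by (simp add: finite_imp_finite_nsets)

lemma reachable_in_vertices:
  assumes "E \<subseteq> K_edges n" "reachable E v w" "v \<in> {1..n}"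
  shows "w \<in> {1..n}"
  using assms(2,3)
proof (induction rule: rtranclp_induct)
  case (step y z)
  then have "{y, z} \<in> K_edges n"
    using assms(1) by blast
  then show ?case
    by simp
qed simp

lemma comp_root_in_vertices: "E \<subseteq> K_edges n \<Longrightarrow> v \<in> {1..n} \<Longrightarrow> comp_root E v \<in> {1..n}"
  by (rule reachable_in_vertices[OF _ reachable_comp_root])

lemma one_in_roots:
  assumes "E \<subseteq> K_edges n" "1 \<le> n"
  shows "1 \<in> roots n E"
  using comp_root_in_vertices[OF assms(1), of 1] comp_root_le[of E 1 1] assms(2)
  by (simp add: roots_def)

lemma forest_subset_K_edges: "E \<in> forests n \<Longrightarrow> E \<subseteq> K_edges n"
  by (simp add: forests_def)

lemma finite_forest: "E \<in> forests n \<Longrightarrow> finite E"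
  using forest_subset_K_edges finite_K_edges finite_subset by blast

lemma forest_subset: "E \<in> forests n \<Longrightarrow> B \<subseteq> E \<Longrightarrow> B \<in> forests n"
  by (auto simp: forests_def is_cycle_def) blast

lemma reachable_parent_edges_comp_root:
  assumes "E \<subseteq> K_edges n" "v \<in> {1..n}"
  shows "reachable ((\<lambda>v. {v, parent E v}) ` ({1..n} - roots n E)) v (comp_root E v)"
    (is "reachable ?P _ _")
  using assms(2)
proof (induction "root_dist E v" arbitrary: v rule: less_induct)
  case less
  show ?case
  proof (cases "comp_root E v = v")
    case False
    have "{v, parent E v} \<in> K_edges n"
      using parent_edge[OF False] assms(1) by blast
    then have "parent E v \<in> {1..n}"
      by simp
    then have "reachable ?P (parent E v) (comp_root E v)"
      using less.hyps[of "parent E v"] root_dist_parent_less[OF False] comp_root_parent[OF False] by simp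
    moreover have "{v, parent E v} \<in> ?P"
      using False less.prems by (auto simp: roots_def)
    ultimately show ?thesis
      by (meson converse_rtranclp_into_rtranclp)
  qed simp
qed

lemma forest_eq_parent_edges:
  assumes "E \<in> forests n"
  shows "E = (\<lambda>v. {v, parent E v}) ` ({1..n} - roots n E)" (is "E = ?P")
proof
  have forest: "E \<subseteq> K_edges n" "\<nexists>vs. is_cycle E vs"
    using assms by (auto simp: forests_def)
  show "?P \<subseteq> E"
    using parent_edge by (auto simp: roots_def)
  show "E \<subseteq> ?P"
  proof (rule ccontr)
    assume "\<not> E \<subseteq> ?P"
    then obtain e where missing: "e \<in> E" "e \<notin> ?P"
      by blast
    then have "e \<in> K_edges n"
      using forest(1) by blast
    then obtain x y where endpoints: "e = {x, y}" "x \<noteq> y" "x \<in> {1..n}" "y \<in> {1..n}"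
      unfolding nsets_2_eq by blast
    have "comp_root E x = comp_root E y"
      using missing(1) endpoints(1) by (intro comp_root_eq) auto
    then have "reachable ?P x (comp_root E y)" "reachable ?P (comp_root E y) y"
      using reachable_parent_edges_comp_root[OF forest(1) endpoints(3)]
        reachable_sym[OF reachable_parent_edges_comp_root[OF forest(1) endpoints(4)]] by simp_all
    then have "reachable ?P x y"
      by (rule rtranclp_trans)
    moreover have "?P \<subseteq> E - {{x, y}}"
      using missing(2) endpoints(1) \<open>?P \<subseteq> E\<close> by blast
    ultimately have "reachable (E - {{x, y}}) x y"
      by (rule reachable_mono[rotated])
    then show False
      using acyclic_edge_separates[OF forest(2)] missing(1) endpoints(1,2) by blast
  qed
qed

lemma card_forest:
  assumes "E \<in> forests n"
  shows "card E + card (roots n E) = n"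
proof -
  have "inj_on (\<lambda>v. {v, parent E v}) ({1..n} - roots n E)"
    by (rule inj_on_subset[OF inj_on_parent_edge]) (auto simp: roots_def)
  then have "card E = card ({1..n} - roots n E)"
    by (subst forest_eq_parent_edges[OF assms]) (rule card_image)
  also have "\<dots> = n - card (roots n E)"
    by (subst card_Diff_subset) (auto simp: roots_def)
  finally have "card E = n - card (roots n E)" .
  moreover have "card (roots n E) \<le> card {1..n}"
    by (rule card_mono) (auto simp: roots_def)
  ultimately show ?thesis
    by simp
qed

lemma card_forest_less: "E \<in> forests n \<Longrightarrow> 1 \<le> n \<Longrightarrow> card E < n"
  using card_forest[of E n] one_in_roots[OF forest_subset_K_edges] finite_roots[of n E]
  by (metis add.right_neutral card_gt_0_iff empty_iff less_add_same_cancel1)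

lemma prod_card_component_le_c_max:
  assumes "B \<in> forests n"
  shows "(\<Prod>\<rho>\<in>roots n B. card (component n B \<rho>)) \<le> c_max n (card B)"
proof (rule prod_le_c_max[OF finite_roots])
  show "0 < card (component n B \<rho>)" if "\<rho> \<in> roots n B" for \<rho>
    using root_in_component[OF that] finite_component by (auto simp: card_gt_0_iff)
  show "card (roots n B) = n - card B"
    using card_forest[OF assms] by simp
  have "(\<Sum>\<rho>\<in>roots n B. card (component n B \<rho>)) = card (\<Union>\<rho>\<in>roots n B. component n B \<rho>)"
    by (rule card_UN_disjoint[symmetric]) (auto simp: component_def roots_def)
  also have "(\<Union>\<rho>\<in>roots n B. component n B \<rho>) = {1..n}"
    using comp_root_in_vertices[OF forest_subset_K_edges[OF assms]] comp_root_idem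
    by (auto simp: component_def roots_def)
  finally show "(\<Sum>\<rho>\<in>roots n B. card (component n B \<rho>)) = n"
    by simp
qed

lemma spanning_tree_forest: "E \<in> spanning_trees n \<Longrightarrow> E \<in> forests n"
  by (simp add: spanning_trees_def)

lemma spanning_tree_subset_K_edges: "E \<in> spanning_trees n \<Longrightarrow> E \<subseteq> K_edges n"
  by (rule forest_subset_K_edges[OF spanning_tree_forest])

lemma comp_root_spanning_tree:
  assumes "E \<in> spanning_trees n" "v \<in> {1..n}"
  shows "comp_root E v = 1"
proof -
  have "reachable E v 1"
    using assms by (simp add: spanning_trees_def connects_iff_reachable)
  then show ?thesis
    using comp_root_le comp_root_in_vertices[OF spanning_tree_subset_K_edges[OF assms(1)] assms(2)]
    by (metis atLeastAtMost_iff le_antisym)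
qed

lemma card_spanning_tree:
  assumes "E \<in> spanning_trees n" "1 \<le> n"
  shows "card E = n - 1"
proof -
  have "roots n E = {1}"
    using comp_root_spanning_tree[OF assms(1)] assms(2) by (auto simp: roots_def)
  then show ?thesis
    using card_forest[OF spanning_tree_forest[OF assms(1)]] by simp
qed

text \<open>A spanning tree \<open>E \<supseteq> B\<close> is rooted at vertex 1. In each component of \<open>B\<close> not containing 1, the vertex
  closest to 1 has its parent edge outside \<open>B\<close>, and \<open>E\<close> consists of \<open>B\<close> and these edges.\<close>

definition top_vertex :: "nat set set \<Rightarrow> nat set \<Rightarrow> nat" where
  "top_vertex E C = (ARG_MIN (root_dist E) v. v \<in> C)"

lemma top_vertex_in: "C \<noteq> {} \<Longrightarrow> top_vertex E C \<in> C"
  and root_dist_top_vertex_le: "v \<in> C \<Longrightarrow> root_dist E (top_vertex E C) \<le> root_dist E v"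
  unfolding top_vertex_def using arg_min_natI arg_min_nat_le by (metis ex_in_conv)+

context
  fixes n :: nat and B E :: "nat set set"
  assumes forest: "B \<in> forests n" and tree: "E \<in> spanning_trees n" and B_subset: "B \<subseteq> E"
    and n_pos: "1 \<le> n"
begin

abbreviation exit_vertex :: "nat \<Rightarrow> nat" where
  "exit_vertex \<rho> \<equiv> top_vertex E (component n B \<rho>)"

lemma exit_vertex_in_component: "\<rho> \<in> roots n B \<Longrightarrow> exit_vertex \<rho> \<in> component n B \<rho>"
  using root_in_component by (blast intro: top_vertex_in)

lemma exit_vertex_not_root:
  assumes "\<rho> \<in> roots n B - {1}"
  shows "comp_root E (exit_vertex \<rho>) \<noteq> exit_vertex \<rho>"
proof -
  have exit: "exit_vertex \<rho> \<in> component n B \<rho>"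
    using assms exit_vertex_in_component by blast
  have "comp_root B 1 = 1"
    using one_in_roots[OF forest_subset_K_edges[OF forest] n_pos] by (simp add: roots_def)
  then have "exit_vertex \<rho> \<noteq> 1"
    using exit assms by (auto simp: component_def)
  then show ?thesis
    using comp_root_spanning_tree[OF tree] exit by (auto simp: component_def)
qed

lemma parent_exit_vertex_in_vertices:
  assumes "\<rho> \<in> roots n B - {1}"
  shows "parent E (exit_vertex \<rho>) \<in> {1..n}"
proof -
  have "{exit_vertex \<rho>, parent E (exit_vertex \<rho>)} \<in> K_edges n"
    using parent_edge[OF exit_vertex_not_root[OF assms]] spanning_tree_subset_K_edges[OF tree] by blast
  then show ?thesis
    by simp
qed

lemma exit_edge_notin_forest:
  assumes "\<rho> \<in> roots n B - {1}"
  shows "{exit_vertex \<rho>, parent E (exit_vertex \<rho>)} \<notin> B"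
proof
  let ?v = "exit_vertex \<rho>"
  assume "{?v, parent E ?v} \<in> B"
  then have "comp_root B ?v = comp_root B (parent E ?v)"
    by (intro comp_root_eq) auto
  then have "parent E ?v \<in> component n B \<rho>"
    using parent_exit_vertex_in_vertices[OF assms] exit_vertex_in_component[of \<rho>] assms
    by (simp add: component_def)
  then show False
    using root_dist_top_vertex_le root_dist_parent_less[OF exit_vertex_not_root[OF assms]]
    by (meson not_le)
qed

lemma inj_on_exit_edge: "inj_on (\<lambda>\<rho>. {exit_vertex \<rho>, parent E (exit_vertex \<rho>)}) (roots n B - {1})"
proof (rule inj_onI)
  fix \<rho> \<sigma> assume roots: "\<rho> \<in> roots n B - {1}" "\<sigma> \<in> roots n B - {1}"
    and eq: "{exit_vertex \<rho>, parent E (exit_vertex \<rho>)} = {exit_vertex \<sigma>, parent E (exit_vertex \<sigma>)}"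
  have "exit_vertex \<rho> = exit_vertex \<sigma>"
  proof (rule inj_onD[OF inj_on_parent_edge[of E]])
    show "{exit_vertex \<rho>, parent E (exit_vertex \<rho>)} = {exit_vertex \<sigma>, parent E (exit_vertex \<sigma>)}"
      by (rule eq)
    show "exit_vertex \<rho> \<in> {v. comp_root E v \<noteq> v}" "exit_vertex \<sigma> \<in> {v. comp_root E v \<noteq> v}"
      by (rule CollectI, rule exit_vertex_not_root, rule roots)+
  qed
  moreover have "comp_root B (exit_vertex \<rho>) = \<rho>" "comp_root B (exit_vertex \<sigma>) = \<sigma>"
    using exit_vertex_in_component roots by (auto simp: component_def)
  ultimately show "\<rho> = \<sigma>"
    by metis
qed

lemma spanning_tree_eq_Un_exit_edges:
  "B \<union> (\<lambda>\<rho>. {exit_vertex \<rho>, parent E (exit_vertex \<rho>)}) ` (roots n B - {1}) = E"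
  (is "B \<union> ?X = E")
proof (rule card_subset_eq)
  show "finite E"
    by (rule finite_forest[OF spanning_tree_forest[OF tree]])
  show "B \<union> ?X \<subseteq> E"
    using B_subset parent_edge[OF exit_vertex_not_root] by blast
  have one: "1 \<in> roots n B"
    by (rule one_in_roots[OF forest_subset_K_edges[OF forest] n_pos])
  have "card (B \<union> ?X) = card B + card ?X"
    using exit_edge_notin_forest
    by (intro card_Un_disjoint finite_forest[OF forest]) (auto simp: finite_roots)
  also have "\<dots> = card B + (card (roots n B) - 1)"
    using card_image[OF inj_on_exit_edge] card_Diff_singleton[OF one] by simp
  also have "\<dots> = n - 1"
  proof -
    have "0 < card (roots n B)"
      using one finite_roots by (auto simp: card_gt_0_iff)
    then show ?thesis
      using card_forest[OF forest] by simp
  qed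
  finally show "card (B \<union> ?X) = card E"
    by (simp add: card_spanning_tree[OF tree n_pos])
qed

end

lemma card_trees_containing_forest_le:
  assumes forest: "B \<in> forests n" and n_pos: "1 \<le> n"
  shows "card (fam_star (spanning_trees n) B) \<le> n ^ (n - card B - 1) * c_max n (card B)"
proof -
  let ?R = "roots n B"
  define D where "D = PiE (?R - {1}) (\<lambda>\<rho>. component n B \<rho> \<times> {1..n})"
  have one: "1 \<in> ?R"
    by (rule one_in_roots[OF forest_subset_K_edges[OF forest] n_pos])
  have "E \<in> (\<lambda>g. B \<union> (\<lambda>\<rho>. {fst (g \<rho>), snd (g \<rho>)}) ` (?R - {1})) ` D"
    if "E \<in> fam_star (spanning_trees n) B" for E
  proof
    define g where "g = (\<lambda>\<rho>\<in>?R - {1}. let v = top_vertex E (component n B \<rho>) in (v, parent E v))"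
    have tree: "E \<in> spanning_trees n" "B \<subseteq> E"
      using that by (auto simp: fam_star_def)
    show "E = B \<union> (\<lambda>\<rho>. {fst (g \<rho>), snd (g \<rho>)}) ` (?R - {1})"
      using spanning_tree_eq_Un_exit_edges[OF forest tree n_pos] by (simp add: g_def Let_def)
    show "g \<in> D"
      using exit_vertex_in_component[OF forest tree n_pos]
        parent_exit_vertex_in_vertices[OF forest tree n_pos]
      by (auto simp: g_def D_def Let_def)
  qed
  moreover have "finite D"
    by (auto simp: D_def finite_roots finite_component intro!: finite_PiE)
  ultimately have "card (fam_star (spanning_trees n) B) \<le> card D"
    by (meson subsetI surj_card_le)
  also have "\<dots> = (\<Prod>\<rho>\<in>?R - {1}. card (component n B \<rho>)) * n ^ card (?R - {1})"
    by (simp add: D_def card_PiE card_cartesian_product finite_roots prod.distrib)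
  also have "card (?R - {1}) = n - card B - 1"
    using card_forest[OF forest] one by (simp add: finite_roots)
  also have "(\<Prod>\<rho>\<in>?R - {1}. card (component n B \<rho>)) \<le> (\<Prod>\<rho>\<in>?R. card (component n B \<rho>))"
  proof -
    have "0 < card (component n B 1)"
      using root_in_component[OF one] finite_component by (auto simp: card_gt_0_iff)
    then show ?thesis
      using prod.remove[OF finite_roots one, of "\<lambda>\<rho>. card (component n B \<rho>)"] by simp
  qed
  also note prod_card_component_le_c_max[OF forest]
  finally show ?thesis
    by (simp add: mult.commute)
qed

lemma card_trees_containing_large_forest_le:
  assumes forest: "B \<in> forests n" "t \<le> card B" and n_ge: "t + 2 \<le> n"
  shows "real (card (fam_star (spanning_trees n) B))
    \<le> real n * (2 / real n) ^ (card B - t) * (real (c_max n t) * real n ^ (n - 2 - t))"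
proof -
  define b where "b = card B - t"
  have "card B < n"
    using card_forest_less[OF forest(1)] n_ge by simp
  then have card_eq: "card B = t + b" "t + b < n" "n - card B - 1 + b = Suc (n - 2 - t)"
    using forest(2) n_ge by (simp_all add: b_def)
  have "card (fam_star (spanning_trees n) B) \<le> n ^ (n - card B - 1) * c_max n (card B)"
    using card_trees_containing_forest_le[OF forest(1)] n_ge by simp
  also have "\<dots> \<le> n ^ (n - card B - 1) * (2 ^ b * c_max n t)"
    using c_max_add_le[OF card_eq(2)] by (simp add: card_eq(1))
  finally have "real (card (fam_star (spanning_trees n) B))
      \<le> real (n ^ (n - card B - 1) * (2 ^ b * c_max n t))"
    by (rule of_nat_mono)
  also have "\<dots> = real n * (2 / real n) ^ b * (real (c_max n t) * real n ^ (n - 2 - t))"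
  proof -
    have "real n ^ (n - card B - 1) * real n ^ b = real n * real n ^ (n - 2 - t)"
      by (metis card_eq(3) power_Suc power_add)
    then show ?thesis
      using n_ge by (simp add: power_divide field_simps)
  qed
  finally show ?thesis
    by (simp add: b_def)
qed

section \<open>Intersecting families of spanning trees\<close>

text \<open>\<open>r ^ (m + a)\<close> times the bound, in units of \<open>c_max n t * n ^ (n - 2 - t)\<close>, on the number of
  trees that contain a forest with \<open>t + m\<close> edges.\<close>

definition forest_weight :: "nat \<Rightarrow> nat \<Rightarrow> real \<Rightarrow> nat \<Rightarrow> real" where
  "forest_weight n a r m = r ^ (m + a) * (real n * (2 / real n) ^ m)"

locale intersecting_trees =
  fixes n t :: nat and F :: "nat set set set"
  assumes n_ge: "t + 2 \<le> n" and trees: "F \<subseteq> spanning_trees n" and intersecting: "t_intersecting t F"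
begin

sublocale set_family "K_edges n" F
proof
  show "finite (K_edges n)"
    by (rule finite_K_edges)
  have "{1, 2} \<in> K_edges n"
    using n_ge by simp
  then show "K_edges n \<noteq> {}"
    by blast
  show "F \<subseteq> Pow (K_edges n)"
    using trees spanning_tree_subset_K_edges by blast
qed

lemma card_member_le: "A \<in> F \<Longrightarrow> card A \<le> n"
  using trees n_ge card_spanning_tree[of A n] by auto

lemma center_forest: "B \<in> spread_centers (K_edges n) r F w \<Longrightarrow> B \<in> forests n"
  using spread_center_subset_member trees spanning_tree_forest forest_subset by blast

abbreviation tree_scale :: real where
  "tree_scale \<equiv> real (c_max n t) * real n ^ (n - 2 - t)"

lemma power_mult_card_fam_star_le_forest_weight:
  assumes "fam_star F B \<noteq> {}" and card_B: "card B = t + m" and "a \<le> t" "0 < r"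
  shows "t + m < n"
    and "r ^ (card B - (t - a)) * real (card (fam_star F B)) \<le> forest_weight n a r m * tree_scale"
proof -
  obtain E where "E \<in> F" "B \<subseteq> E"
    using assms(1) by (auto simp: fam_star_def)
  then have forest: "B \<in> forests n"
    using trees spanning_tree_forest forest_subset by blast
  then show "t + m < n"
    using card_forest_less card_B n_ge by fastforce
  have "fam_star (spanning_trees n) B \<subseteq> Pow (K_edges n)"
    using spanning_tree_subset_K_edges by (auto simp: fam_star_def)
  then have "finite (fam_star (spanning_trees n) B)"
    by (rule finite_subset) (simp only: finite_Pow_iff finite_K_edges)
  then have "card (fam_star F B) \<le> card (fam_star (spanning_trees n) B)"
    using trees by (auto simp: fam_star_def intro: card_mono)
  then have "real (card (fam_star F B)) \<le> real (card (fam_star (spanning_trees n) B))"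
    by simp
  also have "\<dots> \<le> real n * (2 / real n) ^ m * tree_scale"
    using card_trees_containing_large_forest_le[OF forest _ n_ge] card_B by simp
  finally have "r ^ (m + a) * real (card (fam_star F B))
      \<le> r ^ (m + a) * (real n * (2 / real n) ^ m * tree_scale)"
    using \<open>0 < r\<close> by (intro mult_left_mono) auto
  moreover have "card B - (t - a) = m + a"
    using card_B \<open>a \<le> t\<close> by simp
  ultimately show "r ^ (card B - (t - a)) * real (card (fam_star F B))
      \<le> forest_weight n a r m * tree_scale"
    by (simp add: forest_weight_def mult.assoc)
qed

lemma mult_power_mult_card_fam_star_le:
  assumes "fam_star F B \<noteq> {}" "t + k < card B" "a \<le> t" "0 < r" and "\<And>j. 0 \<le> c j"
    and weight: "\<And>m. k < m \<Longrightarrow> t + m < n \<Longrightarrow> c (t + m) * forest_weight n a r m \<le> \<delta>"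
  shows "c (card B) * (r ^ (card B - (t - a)) * real (card (fam_star F B))) \<le> \<delta> * tree_scale"
proof -
  define m where "m = card B - t"
  have card_B: "card B = t + m" "k < m"
    using assms(2) by (simp_all add: m_def)
  note star_le = power_mult_card_fam_star_le_forest_weight[OF assms(1) card_B(1) assms(3,4)]
  have "c (card B) * (r ^ (card B - (t - a)) * real (card (fam_star F B)))
      \<le> c (card B) * (forest_weight n a r m * tree_scale)"
    using star_le(2) assms(5) by (rule mult_left_mono)
  also have "\<dots> = (c (t + m) * forest_weight n a r m) * tree_scale"
    by (simp add: card_B(1) mult.assoc)
  also have "\<dots> \<le> \<delta> * tree_scale"
    using weight[OF card_B(2) star_le(1)] by (rule mult_right_mono) simp
  finally show ?thesis .
qed

lemma coarse_centers_t_intersecting: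
  assumes "2 * sqrt (real n) \<le> real a"
  shows "t_intersecting (t - a) (spread_centers (K_edges n) (sqrt (real n)) F w)"
  unfolding t_intersecting_def
proof (intro ballI)
  fix B B' assume centers: "B \<in> spread_centers (K_edges n) (sqrt (real n)) F w"
    "B' \<in> spread_centers (K_edges n) (sqrt (real n)) F w"
  have "real t \<le> real (card (B \<inter> B')) + 2 * real n / sqrt (real n)"
    by (rule spread_centers_almost_intersecting[OF intersecting card_member_le centers])
  also have "2 * real n / sqrt (real n) = 2 * sqrt (real n)"
    using real_div_sqrt[of "real n"] by simp
  finally have "real t \<le> real (card (B \<inter> B') + a)"
    using assms by simp
  then show "t - a \<le> card (B \<inter> B')"
    by simp
qed

lemma card_uncovered_coarse_le:
  assumes defect: "2 * sqrt (real n) \<le> real a" "a \<le> t" and "0 \<le> \<delta>"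
    and weight: "\<And>m. k < m \<Longrightarrow> t + m < n \<Longrightarrow>
      real ((t + m) choose (t - a)) * forest_weight n a (sqrt (real n)) m \<le> \<delta>"
  shows "real (card (uncovered F (spread_centers (K_edges n) (sqrt (real n)) F (t + k))))
    \<le> real n * (\<delta> * tree_scale)"
proof -
  have "real (card (uncovered F (spread_centers (K_edges n) (sqrt (real n)) F (t + k))))
      \<le> real (n - (t + k)) * (\<delta> * tree_scale)"
  proof (rule card_uncovered_spread_centers_iterated_le[OF _ _ card_member_le])
    show "t_intersecting (t - a) (spread_centers (K_edges n) (sqrt (real n)) F w)" for w
      by (rule coarse_centers_t_intersecting[OF defect(1)])
    show "real (card B choose (t - a))
          * (sqrt (real n) ^ (card B - (t - a)) * real (card (fam_star F B)))
        \<le> \<delta> * tree_scale" if "t + k < card B" "fam_star F B \<noteq> {}" for B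
      using n_ge by (intro mult_power_mult_card_fam_star_le[OF that(2,1) defect(2)] weight) simp_all
  qed (use n_ge \<open>0 \<le> \<delta>\<close> in auto)
  also have "\<dots> \<le> real n * (\<delta> * tree_scale)"
    using \<open>0 \<le> \<delta>\<close> by (intro mult_right_mono) auto
  finally show ?thesis .
qed

lemma card_uncovered_fine_le:
  assumes defect: "2 * sqrt (real n) \<le> real a" "a \<le> t" and "0 \<le> \<delta>" "1 < r"
    and weight: "\<And>m. k < m \<Longrightarrow> t + m < n \<Longrightarrow>
      real ((t + l) choose (t - a)) * forest_weight n a r m \<le> \<delta>"
  shows "real (card (uncovered F (spread_centers (K_edges n) r F (t + k))))
    \<le> real (card (uncovered F (spread_centers (K_edges n) (sqrt (real n)) F (t + l))))
      + \<delta> * tree_scale"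
proof (rule card_uncovered_spread_centers_le[OF \<open>1 < r\<close> _ spread_centers_subset_Pow _
      coarse_centers_t_intersecting[OF defect(1)]])
  show "real ((t + l) choose (t - a)) * (r ^ (card B - (t - a)) * real (card (fam_star F B)))
      \<le> \<delta> * tree_scale" if "t + k < card B" "fam_star F B \<noteq> {}" for B
    using \<open>1 < r\<close> by (intro mult_power_mult_card_fam_star_le[OF that(2,1) defect(2)] weight) simp_all
qed (use \<open>0 \<le> \<delta>\<close> in \<open>auto simp: spread_centers_def\<close>)

end

section \<open>Estimates\<close>

lemma ln_2_le_1: "ln (2::real) \<le> 1"
  using ln_add_one_self_le_self[of 1] by simp

lemma ln_2_ge_half: "1 / 2 \<le> ln (2::real)"
  using exp_half_le2 ln_ge_iff[of 2 "1 / 2"] by simp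

lemma binomial_mult_power_le:
  fixes x :: real
  assumes "0 \<le> x"
  shows "real (N choose k) * x ^ k \<le> (1 + x) ^ N"
proof (cases "k \<le> N")
  case True
  have "real (N choose k) * x ^ k \<le> (\<Sum>k\<le>N. real (N choose k) * x ^ k)"
    using True assms by (intro member_le_sum) auto
  also have "\<dots> = (1 + x) ^ N"
    by (simp add: binomial_ring add.commute[of 1])
  finally show ?thesis .
qed (use assms in \<open>simp add: binomial_eq_0\<close>)

lemma binomial_le_exp:
  assumes "N \<le> n" "0 < n"
  shows "real (N choose k) \<le> exp (real n powr (3 / 4) + real k * (ln (real n) / 4))"
proof -
  define x where "x = real n powr (- 1 / 4)"
  have "x ^ k = exp (- (real k * (ln (real n) / 4)))"
    using assms(2) by (simp add: x_def powr_def flip: exp_of_nat_mult)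
  then have "real (N choose k) = real (N choose k) * x ^ k * exp (real k * (ln (real n) / 4))"
    by (simp add: exp_minus)
  also have "\<dots> \<le> (1 + x) ^ N * exp (real k * (ln (real n) / 4))"
    by (intro mult_right_mono binomial_mult_power_le) (auto simp: x_def)
  also have "(1 + x) ^ N \<le> exp (real N * x)"
    by (rule one_plus_power_le_exp) (simp add: x_def)
  also have "real N * x \<le> real n * x"
    using assms(1) by (intro mult_right_mono) (auto simp: x_def)
  also have "real n * x = real n powr (3 / 4)"
    using assms(2) by (simp add: x_def powr_mult_base)
  finally show ?thesis
    by (simp add: exp_add)
qed

lemma forest_weight_sqrt_eq:
  assumes "0 < n"
  shows "forest_weight n a (sqrt (real n)) m
    = exp (real (m + a) * (ln (real n) / 2) + ln (real n) + real m * (ln 2 - ln (real n)))"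
proof -
  have "sqrt (real n) = exp (ln (real n) / 2)" "2 / real n = exp (ln 2 - ln (real n))"
    using assms by (simp_all add: exp_diff powr_def flip: powr_half_sqrt)
  then have "sqrt (real n) ^ (m + a) = exp (real (m + a) * (ln (real n) / 2))"
    "(2 / real n) ^ m = exp (real m * (ln 2 - ln (real n)))"
    by (simp_all only: exp_of_nat_mult)
  moreover have "real n = exp (ln (real n))"
    using assms by simp
  ultimately show ?thesis
    unfolding forest_weight_def by (metis exp_add mult.assoc)
qed

lemma coarse_weight_le:
  assumes "0 < n" "8 \<le> ln (real n)" "t + m < n" "a \<le> t" "real a \<le> 2 * sqrt (real n) + 1"
    and "z \<le> real m" "0 \<le> y"
    and dominates: "real n powr (3 / 4) + (3 / 4) * (2 * sqrt (real n) + 1) * ln (real n)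
      + 2 * ln (real n) + 1 + y \<le> z"
  shows "real ((t + m) choose (t - a)) * forest_weight n a (sqrt (real n)) m
    \<le> 2 powr (- (1 / 2) * y) / (2 * real n)"
proof -
  let ?L = "ln (real n)"
  have "(t + m) choose (t - a) = (t + m) choose (m + a)"
    using binomial_symmetric[of "t - a" "t + m"] assms(4) by simp
  then have "real ((t + m) choose (t - a)) \<le> exp (real n powr (3 / 4) + real (m + a) * (?L / 4))"
    using binomial_le_exp[of "t + m" n "m + a"] assms(1,3) by simp
  then have "real ((t + m) choose (t - a)) * forest_weight n a (sqrt (real n)) m
      \<le> exp (real n powr (3 / 4) + real (m + a) * (?L / 4))
        * exp (real (m + a) * (?L / 2) + ?L + real m * (ln 2 - ?L))"
    unfolding forest_weight_sqrt_eq[OF assms(1)] by (rule mult_right_mono) simp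
  also have "\<dots> = exp (real n powr (3 / 4) + (3 / 4) * real a * ?L + ?L - real m * (?L / 4 - ln 2))"
    by (simp add: algebra_simps flip: exp_add)
  also have "\<dots> \<le> exp (- (1 / 2) * y * ln 2 - (ln 2 + ?L))"
  proof -
    have "real m * 1 \<le> real m * (?L / 4 - ln 2)"
      using assms(2) ln_2_le_1 by (intro mult_left_mono) auto
    moreover have "real a * ?L \<le> (2 * sqrt (real n) + 1) * ?L"
      using assms(2,5) by (intro mult_right_mono) auto
    moreover have "y * ln 2 \<le> y * 1"
      using \<open>0 \<le> y\<close> ln_2_le_1 by (intro mult_left_mono) auto
    ultimately show ?thesis
      using dominates \<open>z \<le> real m\<close> \<open>0 \<le> y\<close> ln_2_le_1
      unfolding exp_le_cancel_iff by (simp add: algebra_simps)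
  qed
  also have "\<dots> = 2 powr (- (1 / 2) * y) / (2 * real n)"
    using assms(1) by (simp add: powr_def[of 2] exp_diff exp_add)
  finally show ?thesis .
qed

lemma forest_weight_le:
  assumes "0 < n" "0 \<le> r" "r \<le> real n / 4"
  shows "forest_weight n a r m \<le> exp ((real a + 1) * ln (real n) - real m * ln 2)"
proof -
  have "forest_weight n a r m = real n * r ^ a * (2 * r / real n) ^ m"
    by (simp add: forest_weight_def power_add power_divide power_mult_distrib)
  also have "\<dots> \<le> real n * real n ^ a * (1 / 2) ^ m"
    using assms by (intro mult_mono power_mono) (auto simp: field_simps)
  also have "\<dots> = real n ^ Suc a * (1 / 2) ^ m"
    by simp
  also have "\<dots> = exp ((real a + 1) * ln (real n) - real m * ln 2)"
  proof -
    have "real n ^ Suc a = exp (real (Suc a) * ln (real n))"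
      using assms(1) by (simp only: exp_of_nat_mult exp_ln of_nat_0_less_iff)
    moreover have "(1 / 2) ^ m = exp (- (real m * ln 2))"
      by (simp add: power_one_over exp_minus exp_of_nat_mult inverse_eq_divide)
    ultimately show ?thesis
      by (simp add: add.commute[of 1] flip: exp_add)
  qed
  finally show ?thesis .
qed

lemma binomial_le_exp_ln:
  assumes "N \<le> 2 * n" "2 \<le> n"
  shows "real (N choose k) \<le> exp (real k * (2 * ln (real n)))"
proof (cases "k \<le> N")
  case True
  have "2 * n \<le> n * n"
    using assms(2) by (rule mult_right_mono) simp
  then have "N \<le> n * n"
    using assms(1) by linarith
  then have "N ^ k \<le> (n * n) ^ k"
    by (rule power_mono) simp
  then have "N choose k \<le> (n * n) ^ k"
    using binomial_le_pow[OF True] by linarith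
  then have "real (N choose k) \<le> real ((n * n) ^ k)"
    by (rule of_nat_mono)
  also have "\<dots> = (real n * real n) ^ k"
    by simp
  also have "\<dots> = exp (real k * (2 * ln (real n)))"
  proof -
    have "0 < real n"
      using assms(2) by simp
    then have "real n * real n = exp (2 * ln (real n))"
      by (simp only: mult_2 exp_add exp_ln)
    then show ?thesis
      unfolding exp_of_nat_mult by (rule arg_cong)
  qed
  finally show ?thesis .
qed (simp add: binomial_eq_0)

lemma fine_weight_le:
  assumes "2 \<le> n" "t \<le> n" "M \<le> n" "a \<le> t" "real a \<le> 2 * sqrt (real n) + 1"
    and "real M \<le> x + 1" "z \<le> real m" "0 \<le> r" "r \<le> real n / 4" "0 \<le> y"
    and dominates: "(2 * (x + 1) + 3 * (2 * sqrt (real n) + 1) + 1) * ln (real n) + y + 1 \<le> z / 2"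
  shows "real ((t + M) choose (t - a)) * forest_weight n a r m \<le> 2 powr (- (1 / 2) * y) / 2"
proof -
  let ?L = "ln (real n)"
  have ln_nonneg: "0 \<le> ?L"
    using assms(1) by simp
  have "(t + M) choose (t - a) = (t + M) choose (M + a)"
    using binomial_symmetric[of "t - a" "t + M"] assms(4) by simp
  then have "real ((t + M) choose (t - a)) \<le> exp (real (M + a) * (2 * ?L))"
    using binomial_le_exp_ln[of "t + M" n "M + a"] assms(1-3) by simp
  then have "real ((t + M) choose (t - a)) * forest_weight n a r m
      \<le> exp (real (M + a) * (2 * ?L)) * exp ((real a + 1) * ?L - real m * ln 2)"
    using forest_weight_le[of n r a m] assms(1,8,9) by (intro mult_mono) (auto simp: forest_weight_def)
  also have "\<dots> = exp ((2 * real M + 3 * real a + 1) * ?L - real m * ln 2)"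
    by (simp add: algebra_simps flip: exp_add)
  also have "\<dots> \<le> exp (- (1 / 2) * y * ln 2 - ln 2)"
  proof -
    have "(2 * real M + 3 * real a + 1) * ?L \<le> (2 * (x + 1) + 3 * (2 * sqrt (real n) + 1) + 1) * ?L"
      using assms(5,6) ln_nonneg by (intro mult_right_mono) auto
    moreover have "real m * (1 / 2) \<le> real m * ln 2"
      using ln_2_ge_half by (intro mult_left_mono) auto
    moreover have "y * ln 2 \<le> y * 1"
      using \<open>0 \<le> y\<close> ln_2_le_1 by (intro mult_left_mono) auto
    ultimately show ?thesis
      using dominates \<open>z \<le> real m\<close> \<open>0 \<le> y\<close> ln_2_le_1
      unfolding exp_le_cancel_iff by (simp add: algebra_simps)
  qed
  also have "\<dots> = 2 powr (- (1 / 2) * y) / 2"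
    by (simp add: powr_def[of 2] exp_diff)
  finally show ?thesis .
qed

section \<open>The approximation for large \<open>n\<close>\<close>

definition sufficiently_large :: "real \<Rightarrow> nat \<Rightarrow> bool" where
  "sufficiently_large \<epsilon> n \<longleftrightarrow> 8 \<le> ln (real n) \<and>
     2 * sqrt (real n) + 1 \<le> 2 * real n powr (1 - \<epsilon> / 7) \<and>
     5120 \<le> 20 * \<epsilon> * real n powr (1 - \<epsilon> / 7) \<and>
     25000 * real n \<le> (20 * \<epsilon> * real n powr (1 - \<epsilon> / 7))\<^sup>2 \<and>
     real n powr (1 - \<epsilon> / 6) + 2 * real n / (20 * \<epsilon> * real n powr (1 - \<epsilon> / 7))
       \<le> 20 * \<epsilon> * real n powr (1 - \<epsilon> / 7) / 2 \<and>
     real n powr (3 / 4) + (3 / 4) * (2 * sqrt (real n) + 1) * ln (real n) + 2 * ln (real n) + 1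
       + real n powr (1 - \<epsilon> / 4) \<le> real n powr (1 - \<epsilon> / 5) \<and>
     (2 * (real n powr (1 - \<epsilon> / 5) + 1) + 3 * (2 * sqrt (real n) + 1) + 1) * ln (real n)
       + real n powr (1 - \<epsilon> / 4) + 1 \<le> real n powr (1 - \<epsilon> / 6) / 2"

lemma eventually_sufficiently_large:
  assumes "0 < \<epsilon>" "\<epsilon> < 1 / 40"
  shows "eventually (sufficiently_large \<epsilon>) sequentially"
  unfolding sufficiently_large_def using assms by (intro eventually_conj; real_asymp)

locale large_intersecting_trees = intersecting_trees n t F
  for n t :: nat and F :: "nat set set set" +
  fixes \<epsilon> :: real
  assumes \<epsilon>_pos: "0 < \<epsilon>" and \<epsilon>_less: "\<epsilon> < 1 / 40" and large: "sufficiently_large \<epsilon> n"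
    and t_ge: "2 * real n powr (1 - \<epsilon> / 7) \<le> real t"
begin

definition spread_ratio :: real where
  "spread_ratio = 10 * \<epsilon> * real t"

definition coarse_defect :: nat where
  "coarse_defect = nat \<lceil>2 * sqrt (real n)\<rceil>"

definition coarse_excess :: nat where
  "coarse_excess = nat \<lceil>real n powr (1 - \<epsilon> / 5)\<rceil>"

definition fine_excess :: nat where
  "fine_excess = nat \<lfloor>real n powr (1 - \<epsilon> / 6)\<rfloor>"

definition coarse_centers :: "nat set set set" where
  "coarse_centers = spread_centers (K_edges n) (sqrt (real n)) F (t + coarse_excess)"

definition fine_centers :: "nat set set set" where
  "fine_centers = spread_centers (K_edges n) spread_ratio F (t + fine_excess)"

lemma coarse_defect_bounds:
  "2 * sqrt (real n) \<le> real coarse_defect" "real coarse_defect \<le> 2 * sqrt (real n) + 1"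
  "coarse_defect \<le> t"
proof -
  show "2 * sqrt (real n) \<le> real coarse_defect" "real coarse_defect \<le> 2 * sqrt (real n) + 1"
    by (simp_all add: coarse_defect_def real_nat_ceiling_ge)
  moreover have "2 * sqrt (real n) + 1 \<le> 2 * real n powr (1 - \<epsilon> / 7)"
    using large by (simp add: sufficiently_large_def)
  ultimately show "coarse_defect \<le> t"
    using t_ge by linarith
qed

lemma coarse_excess_bounds:
  "real n powr (1 - \<epsilon> / 5) \<le> real coarse_excess" "real coarse_excess \<le> real n powr (1 - \<epsilon> / 5) + 1"
  "coarse_excess \<le> n"
proof -
  show "real n powr (1 - \<epsilon> / 5) \<le> real coarse_excess"
    "real coarse_excess \<le> real n powr (1 - \<epsilon> / 5) + 1"
    by (simp_all add: coarse_excess_def real_nat_ceiling_ge)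
  have "real n powr (1 - \<epsilon> / 5) \<le> real n powr 1"
    using \<epsilon>_pos n_ge by (intro powr_mono) auto
  then show "coarse_excess \<le> n"
    by (simp add: coarse_excess_def nat_le_iff ceiling_le_iff)
qed

lemma fine_excess_bounds:
  "real fine_excess \<le> real n powr (1 - \<epsilon> / 6)" "fine_excess < m \<Longrightarrow> real n powr (1 - \<epsilon> / 6) \<le> real m"
  unfolding fine_excess_def by (simp add: of_nat_floor) linarith

lemma spread_ratio_ge: "20 * \<epsilon> * real n powr (1 - \<epsilon> / 7) \<le> spread_ratio"
  using mult_left_mono[OF t_ge, of "10 * \<epsilon>"] \<epsilon>_pos by (simp add: spread_ratio_def mult_ac)

lemma spread_ratio_ge_5120: "5120 \<le> spread_ratio"
  using spread_ratio_ge large by (simp add: sufficiently_large_def)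

lemma spread_ratio_le: "spread_ratio \<le> real n / 4"
proof -
  have "10 * \<epsilon> * real t \<le> 1 / 4 * real n"
    using \<epsilon>_pos \<epsilon>_less n_ge by (intro mult_mono) auto
  then show ?thesis
    by (simp add: spread_ratio_def)
qed

lemma card_uncovered_coarse_centers_le:
  "real (card (uncovered F coarse_centers))
    \<le> 2 powr (- (1 / 2) * real n powr (1 - \<epsilon> / 4)) / 2 * tree_scale"
proof -
  define D where "D = 2 powr (- (1 / 2) * real n powr (1 - \<epsilon> / 4))"
  have "real ((t + m) choose (t - coarse_defect)) * forest_weight n coarse_defect (sqrt (real n)) m
      \<le> D / (2 * real n)" if "coarse_excess < m" "t + m < n" for m
    unfolding D_def
  proof (rule coarse_weight_le)
    show "8 \<le> ln (real n)" and "real n powr (3 / 4) + (3 / 4) * (2 * sqrt (real n) + 1) * ln (real n)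
        + 2 * ln (real n) + 1 + real n powr (1 - \<epsilon> / 4) \<le> real n powr (1 - \<epsilon> / 5)"
      using large by (simp_all add: sufficiently_large_def)
    show "real n powr (1 - \<epsilon> / 5) \<le> real m"
      using coarse_excess_bounds(1) that(1) by linarith
  qed (use n_ge that(2) coarse_defect_bounds in auto)
  then have "real (card (uncovered F coarse_centers))
      \<le> real n * (D / (2 * real n) * tree_scale)"
    unfolding coarse_centers_def
    by (intro card_uncovered_coarse_le[OF coarse_defect_bounds(1,3)]) (simp_all add: D_def)
  then show ?thesis
    using n_ge by (simp add: D_def)
qed

lemma card_uncovered_fine_centers_le:
  "real (card (uncovered F fine_centers))
    \<le> 2 powr (- (1 / 2) * real n powr (1 - \<epsilon> / 4)) * tree_scale"
proof -
  define D where "D = 2 powr (- (1 / 2) * real n powr (1 - \<epsilon> / 4))"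
  have "real ((t + coarse_excess) choose (t - coarse_defect))
        * forest_weight n coarse_defect spread_ratio m \<le> D / 2" if "fine_excess < m" for m
    unfolding D_def
  proof (rule fine_weight_le)
    show "(2 * (real n powr (1 - \<epsilon> / 5) + 1) + 3 * (2 * sqrt (real n) + 1) + 1) * ln (real n)
        + real n powr (1 - \<epsilon> / 4) + 1 \<le> real n powr (1 - \<epsilon> / 6) / 2"
      using large by (simp add: sufficiently_large_def)
    show "real n powr (1 - \<epsilon> / 6) \<le> real m"
      by (rule fine_excess_bounds(2)[OF that])
  qed (use n_ge coarse_defect_bounds coarse_excess_bounds spread_ratio_ge_5120 spread_ratio_le in auto)
  then have "real (card (uncovered F fine_centers))
      \<le> real (card (uncovered F coarse_centers)) + D / 2 * tree_scale"
    unfolding fine_centers_def coarse_centers_def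
    using spread_ratio_ge_5120
    by (intro card_uncovered_fine_le[OF coarse_defect_bounds(1,3)]) (simp_all add: D_def)
  then show ?thesis
    using card_uncovered_coarse_centers_le by (simp add: D_def field_simps)
qed

lemma fine_centers_t_intersecting: "t_intersecting t fine_centers"
  unfolding fine_centers_def
proof (rule spread_centers_t_intersecting[OF intersecting card_member_le spread_ratio_ge_5120])
  define s where "s = 20 * \<epsilon> * real n powr (1 - \<epsilon> / 7)"
  have s_bounds: "5120 \<le> s" "25000 * real n \<le> s\<^sup>2" "real n powr (1 - \<epsilon> / 6) + 2 * real n / s \<le> s / 2"
    using large unfolding sufficiently_large_def s_def by blast+
  have "s \<le> spread_ratio"
    unfolding s_def by (rule spread_ratio_ge)
  then have "s\<^sup>2 \<le> spread_ratio\<^sup>2" and "2 * real n / spread_ratio \<le> 2 * real n / s"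
    using s_bounds(1) by (auto intro: power_mono divide_left_mono)
  with s_bounds \<open>s \<le> spread_ratio\<close> fine_excess_bounds(1)
  show "25000 * real n \<le> spread_ratio\<^sup>2"
    and "real (t + fine_excess) + 2 * real n / spread_ratio \<le> real t + spread_ratio / 2"
    by linarith+
qed

lemma card_fine_center_le: "B \<in> fine_centers \<Longrightarrow> real (card B) \<le> real t + real n powr (1 - \<epsilon> / 6)"
  using fine_excess_bounds(1) by (auto simp: fine_centers_def spread_centers_def)

lemma fine_centers_subset_forests: "fine_centers \<subseteq> forests n"
  unfolding fine_centers_def using center_forest by blast

lemma ex_spread_fam_link_fine_center:
  "B \<in> fine_centers \<Longrightarrow> \<exists>H\<subseteq>F. spread (K_edges n) (10 * \<epsilon> * real t) (fam_link H B)"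
  by (simp add: fine_centers_def spread_centers_def spread_ratio_def)

lemma diff_uncovered_subset_fam_stars: "F - uncovered F S \<subseteq> fam_stars (spanning_trees n) S"
  using trees by (auto simp: uncovered_def fam_stars_def fam_star_def)

end

theorem theorem23:
  shows "\<exists>\<epsilon>0 > 0. \<forall>\<epsilon>::real. 0 < \<epsilon> \<and> \<epsilon> < \<epsilon>0 \<longrightarrow>
    (\<exists>n0 t0 :: nat. \<forall>n > n0. \<forall>t :: nat. \<forall>\<F>.
       t \<ge> 1 \<and> 2 * real n powr (1 - \<epsilon> / 7) \<le> real t \<and> t + 2 \<le> n \<and> t > t0 \<and>
       \<F> \<subseteq> spanning_trees n \<and> t_intersecting t \<F> \<longrightarrow>
       (\<exists>\<S> \<F>'.
          \<S> \<subseteq> forests n \<and> t_intersecting t \<S> \<and>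
          (\<forall>B\<in>\<S>. real (card B) \<le> real t + real n powr (1 - \<epsilon> / 6)) \<and>
          \<F>' \<subseteq> \<F> \<and>
          \<F> - \<F>' \<subseteq> fam_stars (spanning_trees n) \<S> \<and>
          (\<forall>B\<in>\<S>. \<exists>\<F>\<^sub>B. \<F>\<^sub>B \<subseteq> \<F> \<and>
             spread (K_edges n) (10 * \<epsilon> * real t) (fam_link \<F>\<^sub>B B)) \<and>
          real (card \<F>') \<le> 2 powr (- (1/2) * real n powr (1 - \<epsilon> / 4))
             * real (c_max n t) * real n ^ (n - 2 - t)))"
proof (rule exI[of _ "1 / 40"], intro conjI allI impI, goal_cases positive approximation)
  case (approximation \<epsilon>)
  then obtain n0 where eventually_large: "\<And>n. n0 \<le> n \<Longrightarrow> sufficiently_large \<epsilon> n"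
    using eventually_sufficiently_large unfolding eventually_sequentially by blast
  show ?case
  proof (rule exI[of _ n0], rule exI[of _ 0], intro allI impI, goal_cases family)
    case (family n t \<F>)
    then interpret large_intersecting_trees n t \<F> \<epsilon>
      using approximation eventually_large by unfold_locales auto
    show ?case
      using fine_centers_subset_forests fine_centers_t_intersecting card_fine_center_le
        diff_uncovered_subset_fam_stars ex_spread_fam_link_fine_center card_uncovered_fine_centers_le
      by (intro exI[of _ fine_centers] exI[of _ "uncovered \<F> fine_centers"])
        (auto simp: uncovered_def mult.assoc)
  qed
qed simp

end
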